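(* Let $G=(V,E)$ be a finite tree with $n$ vertices, and let $D$ be its distance matrix, i.e. the $V\times V$ matrix whose $(u,v)$-entry is the number of edges on the unique path from $u$ to $v$. Let $S\subseteq V$ be a nonempty subset of vertices and let $D[S]$ be the principal submatrix of $D$ with rows and columns indexed by $S$. Then \[ \det D[S] = (-1)^{|S|-1}\, 2^{|S|-2}\Big( (n-1)\,\kappa(G;S) - \sum_{F\in\mathcal{F}_2(G;S)} \big(\operatorname{outdeg}(F,* )-2\big)^2\Big), \] where $\kappa(G;S)$ is the number of $S$-rooted spanning forests of $G$, $\mathcal{F}_2(G;S)$ is the set of $(S,* )$-rooted spanning forests of $G$, and $\operatorname{outdeg}(F,* )$ is the outdegree of the floating component of $F$.
   Context: A spanning forest of $G$ is an acyclic subgraph containing all vertices of $G$. An $S$-rooted spanning forest is a spanning forest each of whose connected components contains exactly one vertex of $S$. An $(S,* )$-rooted spanning forest is a spanning forest with $|S|+1$ connected components, $|S|$ of which each contain exactly one vertex of $S$, and one additional component (the floating component, denoted $F( * )$) containing no vertex of $S$. The outdegree $\operatorname{outdeg}(F,* )$ is the number of edges of $G$ having exactly one endpoint in the vertex set of $F( * )$. *)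

theory Defs
  imports "Jordan_Normal_Form.Determinant" "Jordan_Normal_Form.DL_Submatrix"
begin

text \<open>
  A finite simple graph is given by its vertex set \<open>V\<close> and its set \<open>E\<close> of two-element edges.
  The predicates \<open>forest\<close> and \<open>tree\<close> of the session \<open>Graph_Theory\<close> are not used: they
  exclude directed cycles, and a symmetric digraph with at least one edge always has a directed
  2-cycle.
\<close>

definition simple_graph :: "'a set \<Rightarrow> 'a set set \<Rightarrow> bool" where
  "simple_graph V E \<longleftrightarrow> finite V \<and> (\<forall>e\<in>E. e \<subseteq> V \<and> card e = 2)"

definition graph_path :: "'a set \<Rightarrow> 'a set set \<Rightarrow> 'a \<Rightarrow> 'a list \<Rightarrow> 'a \<Rightarrow> bool" where
  "graph_path V E u p v \<longleftrightarrow> p \<noteq> [] \<and> hd p = u \<and> last p = v \<and> set p \<subseteq> V \<and> distinct p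
     \<and> successively (\<lambda>x y. {x, y} \<in> E) p"

definition graph_connected :: "'a set \<Rightarrow> 'a set set \<Rightarrow> bool" where
  "graph_connected V E \<longleftrightarrow> V \<noteq> {} \<and> (\<forall>u\<in>V. \<forall>v\<in>V. \<exists>p. graph_path V E u p v)"

text \<open>The closing edge of a cycle \<open>p\<close> joins its last vertex to its first one.\<close>

definition graph_cycle :: "'a set \<Rightarrow> 'a set set \<Rightarrow> 'a list \<Rightarrow> bool" where
  "graph_cycle V E p \<longleftrightarrow> length p \<ge> 3 \<and> set p \<subseteq> V \<and> distinct p
     \<and> successively (\<lambda>x y. {x, y} \<in> E) p \<and> {last p, hd p} \<in> E"

definition graph_acyclic :: "'a set \<Rightarrow> 'a set set \<Rightarrow> bool" where
  "graph_acyclic V E \<longleftrightarrow> (\<nexists>p. graph_cycle V E p)"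

definition finite_tree :: "'a set \<Rightarrow> 'a set set \<Rightarrow> bool" where
  "finite_tree V E \<longleftrightarrow> simple_graph V E \<and> graph_connected V E \<and> graph_acyclic V E"

text \<open>A path is a list of vertices, so it has one edge less than its length.\<close>

definition tree_dist :: "'a set \<Rightarrow> 'a set set \<Rightarrow> 'a \<Rightarrow> 'a \<Rightarrow> nat" where
  "tree_dist V E u v = length (THE p. graph_path V E u p v) - 1"

text \<open>
  Matrices are indexed by natural numbers, so a \<open>V \<times> V\<close> matrix is written down with respect to an
  enumeration \<open>vs\<close> of \<open>V\<close>; the index set corresponding to \<open>S \<subseteq> V\<close> is \<open>positions vs S\<close>.
\<close>

definition distance_matrix :: "'a set \<Rightarrow> 'a set set \<Rightarrow> 'a list \<Rightarrow> real mat" where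
  "distance_matrix V E vs =
     mat (length vs) (length vs) (\<lambda>(i, j). real (tree_dist V E (vs ! i) (vs ! j)))"

definition positions :: "'a list \<Rightarrow> 'a set \<Rightarrow> nat set" where
  "positions vs S = {i. i < length vs \<and> vs ! i \<in> S}"

definition principal_submatrix :: "'b mat \<Rightarrow> nat set \<Rightarrow> 'b mat" where
  "principal_submatrix A I = submatrix A I I"

text \<open>A spanning subgraph has vertex set \<open>V\<close>, so it is represented by its edge set \<open>F \<subseteq> E\<close>.\<close>

definition spanning_forest :: "'a set \<Rightarrow> 'a set set \<Rightarrow> 'a set set \<Rightarrow> bool" where
  "spanning_forest V E F \<longleftrightarrow> F \<subseteq> E \<and> graph_acyclic V F"

text \<open>Vertex sets of the connected components of \<open>(V, F)\<close>.\<close>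

definition graph_components :: "'a set \<Rightarrow> 'a set set \<Rightarrow> 'a set set" where
  "graph_components V F = (\<lambda>u. {v\<in>V. \<exists>p. graph_path V F u p v}) ` V"

definition rooted_forests :: "'a set \<Rightarrow> 'a set set \<Rightarrow> 'a set \<Rightarrow> 'a set set set" where
  "rooted_forests V E S =
     {F. spanning_forest V E F \<and> (\<forall>C\<in>graph_components V F. \<exists>!s. s \<in> C \<and> s \<in> S)}"

definition kappa :: "'a set \<Rightarrow> 'a set set \<Rightarrow> 'a set \<Rightarrow> nat" where
  "kappa V E S = card (rooted_forests V E S)"

definition floating_rooted_forests :: "'a set \<Rightarrow> 'a set set \<Rightarrow> 'a set \<Rightarrow> 'a set set set" where
  "floating_rooted_forests V E S =
     {F. spanning_forest V E F
       \<and> card (graph_components V F) = card S + 1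
       \<and> card {C\<in>graph_components V F. \<exists>!s. s \<in> C \<and> s \<in> S} = card S
       \<and> (\<exists>!C. C \<in> graph_components V F \<and> C \<inter> S = {})}"

definition floating_component :: "'a set \<Rightarrow> 'a set \<Rightarrow> 'a set set \<Rightarrow> 'a set" where
  "floating_component V S F = (THE C. C \<in> graph_components V F \<and> C \<inter> S = {})"

definition outdeg :: "'a set \<Rightarrow> 'a set set \<Rightarrow> 'a set \<Rightarrow> 'a set set \<Rightarrow> nat" where
  "outdeg V E S F = card {e\<in>E. card (e \<inter> floating_component V S F) = 1}"

end

theory Submission
  imports Defs
begin

text \<open>
  Let \<open>L\<close> be the Laplacian of the tree and \<open>\<tau> = 2 - deg\<close>. By the identities of Graham and Lovasz
  \<open>L D = \<tau> 1\<^sup>T - 2 I\<close> and \<open>D \<tau> = (n - 1) 1\<close>, the distance matrix bordered by a row and a column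
  of ones has as inverse \<open>- 1/2\<close> times \<open>L\<close> bordered by \<open>- \<tau>\<close> with corner \<open>n - 1\<close>. Hence
  \<open>det D[S]\<close> is, up to a power of \<open>- 2\<close>, the minor of the bordered Laplacian on the complement
  of \<open>S\<close> together with the border. Such a minor is a sum over forests, by elimination of leaves:
  the \<open>S\<close>-rooted forests come with the corner \<open>n - 1\<close>, and a forest with floating component \<open>C\<close>
  contributes \<open>- (\<Sum>i\<in>C. \<tau> i)\<^sup>2\<close>. As \<open>C\<close> is a subtree, this sum of \<open>\<tau>\<close> is \<open>2 - outdeg\<close>.
\<close>

section \<open>Determinants indexed by finite sets\<close>

text \<open>The border avoids a division. For n >= 2 the inverse of \<open>D\<close> itself is
  \<open>- L / 2\<close> plus \<tau> times its transpose over \<open>2 (n - 1)\<close>; this breaks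
  down at n = 1, and its minors mix a rank-one term into \<open>L\<close>. An extra index separates
  the two parts and treats all n alike.

  The obstacle to an induction over leaves is that elimination does not preserve the data: after a
  pivot the border is no longer 2 minus the degree in the smaller tree, and the corner no longer its
  size minus 1. The forest formula is therefore proved for an arbitrary border \<open>t\<close>,
  corner \<open>c\<close> and root set, and the degrees enter only afterwards. On the forest side
  the weights are built from one factor per component, so that attaching a leaf alters a single
  factor.

  The 4 behind the exponent \<open>|S| - 2\<close> is the square of the total of \<tau>, which is 2:
  the minor with no roots is -4.\<close>

definition list_det :: "'b list \<Rightarrow> ('b \<Rightarrow> 'b \<Rightarrow> real) \<Rightarrow> real" where
  "list_det xs f = det (mat (length xs) (length xs) (\<lambda>(i, j). f (xs ! i) (xs ! j)))"

text \<open>The same permutation acts on rows and on columns, so its sign occurs squared.\<close>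

lemma list_det_permute:
  assumes "mset xs = mset ys"
  shows "list_det xs f = list_det ys f"
proof -
  let ?n = "length ys"
  obtain p where p: "p permutes {..<?n}" "permute_list p ys = xs"
    using mset_eq_permutation[OF assms] by blast
  have p': "p permutes {0..<?n}" using p(1) by (simp add: atLeast0LessThan)
  have len: "length xs = ?n" using assms mset_eq_length by blast
  have pn: "p i < ?n" if "i < ?n" for i
    using permutes_in_image[OF p(1)] that by auto
  have nth: "xs ! i = ys ! p i" if "i < ?n" for i
    using permute_list_nth[OF p(1) that] p(2) by simp
  define B where "B = mat ?n ?n (\<lambda>(i, j). f (ys ! i) (ys ! j))"
  define C where "C = mat ?n ?n (\<lambda>(i, j). B $$ (i, p j))"
  have B: "B \<in> carrier_mat ?n ?n" and C: "C \<in> carrier_mat ?n ?n"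
    by (simp_all add: B_def C_def)
  have "mat (length xs) (length xs) (\<lambda>(i, j). f (xs ! i) (xs ! j))
      = mat ?n ?n (\<lambda>(i, j). C $$ (p i, j))"
    by (rule eq_matI) (auto simp: len nth pn C_def B_def)
  then have "list_det xs f = signof p * det C"
    using det_permute_rows[OF C p'] by (simp add: list_det_def)
  also have "det C = det (transpose_mat C)" using det_transpose[OF C] by simp
  also have "transpose_mat C = mat ?n ?n (\<lambda>(i, j). transpose_mat B $$ (p i, j))"
    by (rule eq_matI) (auto simp: C_def B_def pn)
  also have "det \<dots> = signof p * det (transpose_mat B)"
    using B by (intro det_permute_rows[OF _ p']) simp
  also have "det (transpose_mat B) = list_det ys f"
    using det_transpose[OF B] by (simp add: list_det_def B_def)
  finally show ?thesis by (simp add: sign_def)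
qed

text \<open>The enumeration picked by \<open>SOME\<close> does not matter, by
  \<open>list_det_permute\<close>; principal minors can thus be indexed by sets of vertices
  directly.\<close>

definition set_det :: "'b set \<Rightarrow> ('b \<Rightarrow> 'b \<Rightarrow> real) \<Rightarrow> real" where
  "set_det A f = list_det (SOME xs. set xs = A \<and> distinct xs) f"

lemma set_det_eq_list_det:
  assumes "distinct xs"
  shows "set_det (set xs) f = list_det xs f"
proof -
  let ?ys = "SOME ys. set ys = set xs \<and> distinct ys"
  have "set ?ys = set xs \<and> distinct ?ys"
    by (rule someI[where x = xs]) (simp add: assms)
  then have "mset ?ys = mset xs" using assms set_eq_iff_mset_eq_distinct by metis
  then show ?thesis unfolding set_det_def by (rule list_det_permute)
qed

lemma set_det_cong:
  assumes "finite A" "\<And>i j. i \<in> A \<Longrightarrow> j \<in> A \<Longrightarrow> f i j = g i j"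
  shows "set_det A f = set_det A g"
proof -
  obtain xs where xs: "set xs = A" "distinct xs" using finite_distinct_list[OF assms(1)] by blast
  have "mat (length xs) (length xs) (\<lambda>(i, j). f (xs ! i) (xs ! j))
      = mat (length xs) (length xs) (\<lambda>(i, j). g (xs ! i) (xs ! j))"
    by (rule eq_matI) (use assms(2) xs in auto)
  then show ?thesis
    using set_det_eq_list_det[OF xs(2)] by (simp add: xs(1) list_det_def)
qed

lemma set_det_empty [simp]: "set_det {} f = 1"
  using set_det_eq_list_det[of "[]" f] by (simp add: list_det_def)

lemma set_det_scale:
  assumes "finite A"
  shows "set_det A (\<lambda>i j. c * f i j) = c ^ card A * set_det A f"
proof -
  obtain xs where xs: "set xs = A" "distinct xs" using finite_distinct_list[OF assms(1)] by blast
  have "mat (length xs) (length xs) (\<lambda>(i, j). c * f (xs ! i) (xs ! j))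
      = c \<cdot>\<^sub>m mat (length xs) (length xs) (\<lambda>(i, j). f (xs ! i) (xs ! j))"
    by (rule eq_matI) auto
  then show ?thesis
    using set_det_eq_list_det[OF xs(2)] distinct_card[OF xs(2)] by (simp add: xs(1) list_det_def)
qed

lemma set_det_transpose:
  assumes "finite A"
  shows "set_det A (\<lambda>i j. f j i) = set_det A f"
proof -
  obtain xs where xs: "set xs = A" "distinct xs" using finite_distinct_list[OF assms(1)] by blast
  let ?M = "mat (length xs) (length xs) (\<lambda>(i, j). f (xs ! i) (xs ! j))"
  have "mat (length xs) (length xs) (\<lambda>(i, j). f (xs ! j) (xs ! i)) = transpose_mat ?M"
    by (rule eq_matI) auto
  then show ?thesis
    using set_det_eq_list_det[OF xs(2)] det_transpose[of ?M "length xs"]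
    by (simp add: xs(1) list_det_def)
qed

lemma set_det_mult:
  assumes "finite A"
  shows "set_det A f * set_det A g = set_det A (\<lambda>i j. \<Sum>k\<in>A. f i k * g k j)"
proof -
  obtain xs where xs: "set xs = A" "distinct xs" using finite_distinct_list[OF assms(1)] by blast
  let ?n = "length xs"
  let ?M = "\<lambda>f. mat ?n ?n (\<lambda>(i, j). f (xs ! i) (xs ! j))"
  have sum: "(\<Sum>k\<in>A. h k) = (\<Sum>k = 0..<?n. h (xs ! k))" for h :: "'a \<Rightarrow> real"
    using sum.reindex_bij_betw[OF bij_betw_nth[OF xs(2) refl xs(1)[symmetric]], of h]
    by (simp add: atLeast0LessThan)
  have "?M (\<lambda>i j. \<Sum>k\<in>A. f i k * g k j) = ?M f * ?M g"
    by (rule eq_matI) (auto simp: sum scalar_prod_def)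
  then show ?thesis
    using set_det_eq_list_det[OF xs(2)] det_mult[of "?M f" ?n "?M g"]
    by (simp add: xs(1) list_det_def)
qed

text \<open>Laplace expansion along row \<open>v\<close>: only the entry at \<open>(v, v)\<close>
  differs, and its cofactor is the minor on \<open>A\<close>.\<close>

lemma set_det_insert_diff:
  assumes "finite A" "v \<notin> A"
    and "\<And>i j. i \<in> A \<Longrightarrow> j \<in> insert v A \<Longrightarrow> f i j = g i j"
    and "\<And>j. j \<in> A \<Longrightarrow> f v j = g v j"
  shows "set_det (insert v A) f = set_det (insert v A) g + (f v v - g v v) * set_det A g"
proof -
  obtain xs where xs: "set xs = A" "distinct xs" using finite_distinct_list[OF assms(1)] by blast
  let ?n = "length xs"
  let ?M = "\<lambda>h. mat (Suc ?n) (Suc ?n) (\<lambda>(i, j). h ((v # xs) ! i) ((v # xs) ! j))"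
  have dist: "distinct (v # xs)" using xs assms(2) by simp
  have ins: "set_det (insert v A) h = det (?M h)" for h
    using set_det_eq_list_det[OF dist, of h] by (simp add: xs(1) list_det_def)
  have del: "det (mat_delete (?M g) 0 0) = set_det A g"
  proof -
    have "mat_delete (?M g) 0 0 = mat ?n ?n (\<lambda>(i, j). g (xs ! i) (xs ! j))"
      by (rule eq_matI) (auto simp: mat_delete_def)
    then show ?thesis using set_det_eq_list_det[OF xs(2), of g] by (simp add: xs(1) list_det_def)
  qed
  have cof: "cofactor (?M f) 0 j = cofactor (?M g) 0 j" if "j < Suc ?n" for j
  proof -
    have "mat_delete (?M f) 0 j = mat_delete (?M g) 0 j"
      by (rule eq_matI) (use that xs assms(3) in \<open>auto simp: mat_delete_def nth_Cons split: nat.split\<close>)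
    then show ?thesis by (simp add: cofactor_def)
  qed
  have lap: "det (?M h) = h v v * cofactor (?M h) 0 0
      + (\<Sum>j<?n. h v (xs ! j) * cofactor (?M h) 0 (Suc j))" for h
    using laplace_expansion_row[of "?M h" "Suc ?n" 0]
    by (simp add: sum.lessThan_Suc_shift del: sum.lessThan_Suc)
  have tail: "(\<Sum>j<?n. f v (xs ! j) * cofactor (?M f) 0 (Suc j))
      = (\<Sum>j<?n. g v (xs ! j) * cofactor (?M g) 0 (Suc j))"
    by (intro sum.cong) (use assms(4) xs cof in auto)
  have "cofactor (?M g) 0 0 = set_det A g" using del by (simp add: cofactor_def)
  then show ?thesis
    unfolding ins lap[of f] lap[of g] tail using cof[of 0] by (simp add: algebra_simps)
qed

text \<open>Clearing row \<open>v\<close> makes the determinant vanish; restoring the diagonal 1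
  then adds the minor on \<open>A\<close>.\<close>

lemma set_det_unit_row:
  assumes "finite A" "v \<notin> A" "f v v = 1" "\<And>j. j \<in> A \<Longrightarrow> f v j = 0"
  shows "set_det (insert v A) f = set_det A f"
proof -
  let ?g = "\<lambda>i j. if i = v then 0 else f i j"
  obtain xs where xs: "set xs = A" "distinct xs" using finite_distinct_list[OF assms(1)] by blast
  have dist: "distinct (v # xs)" using xs assms(2) by simp
  let ?M = "mat (Suc (length xs)) (Suc (length xs)) (\<lambda>(i, j). ?g ((v # xs) ! i) ((v # xs) ! j))"
  have "det ?M = 0"
    using laplace_expansion_row[of ?M "Suc (length xs)" 0] by simp
  then have "set_det (insert v A) ?g = 0"
    using set_det_eq_list_det[OF dist, of ?g] by (simp add: xs(1) list_det_def)
  moreover have "set_det (insert v A) f = set_det (insert v A) ?g + (f v v - ?g v v) * set_det A ?g"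
    by (rule set_det_insert_diff) (use assms in auto)
  moreover have "set_det A ?g = set_det A f"
    by (rule set_det_cong) (use assms in auto)
  ultimately show ?thesis using assms(3) by simp
qed

lemma set_det_unit_rows:
  assumes "finite B" "finite A" "A \<inter> B = {}"
    and "\<And>i j. i \<in> B \<Longrightarrow> j \<in> A \<union> B \<Longrightarrow> f i j = of_bool (i = j)"
  shows "set_det (A \<union> B) f = set_det A f"
  using assms
proof (induction B rule: finite_induct)
  case (insert b B)
  have "set_det (insert b (A \<union> B)) f = set_det (A \<union> B) f"
    by (rule set_det_unit_row) (use insert in auto)
  also have "\<dots> = set_det A f" by (rule insert.IH) (use insert.prems in auto)
  finally show ?case by simp
qed simp

text \<open>Schur complement of a pivot 1. The elimination is the factorization of \<open>f\<close>
  into \<open>?e\<close>, the identity with column \<open>v\<close> of \<open>f\<close> put in, and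
  \<open>?h\<close>, the matrix after elimination.\<close>

lemma set_det_pivot:
  assumes "finite A" "v \<notin> A" "f v v = 1"
  shows "set_det (insert v A) f = set_det A (\<lambda>i j. f i j - f i v * f v j)"
proof -
  let ?A = "insert v A"
  let ?e = "\<lambda>i j. if i = j then 1 else if j = v then f i v else 0"
  let ?h = "\<lambda>i j. if i = v then f v j else f i j - f i v * f v j"
  let ?I = "\<lambda>i j :: 'a. of_bool (i = j) :: real"
  have "set_det ({} \<union> A) ?I = set_det {} ?I"
    by (rule set_det_unit_rows) (use assms in auto)
  moreover have "set_det A ?e = set_det A ?I"
    by (rule set_det_cong) (use assms in auto)
  ultimately have "set_det A ?e = 1" by simp
  moreover have "set_det ?A ?e = set_det A ?e"
    by (rule set_det_unit_row) (use assms in auto)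
  ultimately have e: "set_det ?A ?e = 1" by simp
  \<comment> \<open>\<open>?h\<close> has a unit column at \<open>v\<close>, so the lemma on unit
    rows applies to the transpose.\<close>
  have "set_det ?A ?h = set_det ?A (\<lambda>i j. ?h j i)"
    using set_det_transpose[of ?A ?h] assms(1) by simp
  also have "\<dots> = set_det A (\<lambda>i j. ?h j i)"
    by (rule set_det_unit_row) (use assms in auto)
  also have "\<dots> = set_det A ?h"
    using set_det_transpose[OF assms(1)] .
  also have "\<dots> = set_det A (\<lambda>i j. f i j - f i v * f v j)"
    by (rule set_det_cong) (use assms in auto)
  finally have h: "set_det ?A ?h = set_det A (\<lambda>i j. f i j - f i v * f v j)" .
  have "set_det ?A f = set_det ?A (\<lambda>i j. \<Sum>k\<in>?A. ?e i k * ?h k j)"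
  proof (rule set_det_cong)
    show "finite ?A" using assms(1) by simp
    fix i j assume i: "i \<in> ?A" and "j \<in> ?A"
    have "(\<Sum>k\<in>?A. ?e i k * ?h k j) = (if i = v then 1 else f i v) * f v j + (\<Sum>k\<in>A. ?e i k * ?h k j)"
      using assms(1,2) by simp
    also have "(\<Sum>k\<in>A. ?e i k * ?h k j) = (\<Sum>k\<in>A. if i = k then ?h k j else 0)"
      by (rule sum.cong) (use assms(2) in auto)
    also have "\<dots> = (if i \<in> A then ?h i j else 0)" using assms(1) by simp
    finally show "f i j = (\<Sum>k\<in>?A. ?e i k * ?h k j)" using i assms(2) by auto
  qed
  also have "\<dots> = set_det ?A ?e * set_det ?A ?h"
    by (rule set_det_mult[symmetric]) (use assms(1) in simp)
  finally show ?thesis using e h by simp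
qed

lemma set_det_singleton: "set_det {v} f = f v v"
proof -
  let ?g = "\<lambda>i j. if i = v \<and> j = v then 1 else f i j"
  have "set_det {v} f = set_det {v} ?g + (f v v - ?g v v) * set_det {} ?g"
    by (rule set_det_insert_diff) auto
  moreover have "set_det {v} ?g = set_det {} ?g"
    by (rule set_det_unit_row) auto
  ultimately show ?thesis by simp
qed

text \<open>Left multiplication of \<open>f\<close> by \<open>g\<close> with its \<open>A\<close>-rows replaced by unit rows gives a
  block triangular matrix whose blocks are \<open>f\<close> restricted to \<open>A\<close> and an identity.\<close>

lemma set_det_jacobi:
  assumes "finite A" "finite B" "A \<inter> B = {}"
    and inv: "\<And>i j. i \<in> A \<union> B \<Longrightarrow> j \<in> A \<union> B \<Longrightarrow> (\<Sum>k\<in>A \<union> B. g i k * f k j) = of_bool (i = j)"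
  shows "set_det B g * set_det (A \<union> B) f = set_det A f"
proof -
  let ?h = "\<lambda>i j. if i \<in> A then of_bool (i = j) else g i j"
  let ?p = "\<lambda>i j. if i \<in> A then f i j else of_bool (i = j)"
  have "set_det (B \<union> A) ?h = set_det B ?h"
    by (rule set_det_unit_rows) (use assms in auto)
  also have "\<dots> = set_det B g"
    by (rule set_det_cong) (use assms in auto)
  finally have "set_det B g * set_det (A \<union> B) f = set_det (A \<union> B) ?h * set_det (A \<union> B) f"
    by (simp add: Un_commute)
  also have "\<dots> = set_det (A \<union> B) (\<lambda>i j. \<Sum>k\<in>A \<union> B. ?h i k * f k j)"
    by (rule set_det_mult) (use assms in simp)
  also have "\<dots> = set_det (A \<union> B) ?p"
  proof (rule set_det_cong)
    fix i j assume ij: "i \<in> A \<union> B" "j \<in> A \<union> B"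
    show "(\<Sum>k\<in>A \<union> B. ?h i k * f k j) = ?p i j"
    proof (cases "i \<in> A")
      case True
      then have "(\<Sum>k\<in>A \<union> B. ?h i k * f k j) = (\<Sum>k\<in>A \<union> B. if i = k then f k j else 0)"
        by (intro sum.cong) auto
      then show ?thesis using True assms(1,2) by simp
    next
      case False
      then show ?thesis using inv[OF ij] by simp
    qed
  qed (use assms in simp)
  also have "\<dots> = set_det A ?p"
    by (rule set_det_unit_rows) (use assms in auto)
  also have "\<dots> = set_det A f"
    by (rule set_det_cong) (use assms in auto)
  finally show ?thesis .
qed

section \<open>Growing a tree by leaves\<close>

definition adjacency :: "'a set set \<Rightarrow> ('a \<times> 'a) set" where
  "adjacency F = {(x, y). {x, y} \<in> F}"

lemma sym_adjacency: "sym (adjacency F)"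
  by (simp add: adjacency_def sym_def insert_commute)

lemma adjacency_insert: "adjacency (insert {v, w} F) = insert (v, w) (insert (w, v) (adjacency F))"
  by (auto simp: adjacency_def doubleton_eq_iff)

lemma reach_closed:
  assumes "\<Union>F \<subseteq> V" "u \<in> V" "(u, x) \<in> (adjacency F)\<^sup>*"
  shows "x \<in> V"
  using assms(3)
proof (induction rule: rtrancl_induct)
  case (step y z)
  then have "z \<in> \<Union>F" unfolding adjacency_def by blast
  then show ?case using assms(1) by blast
qed (rule assms(2))

lemma graph_path_refl: "u \<in> V \<Longrightarrow> graph_path V E u [u] u"
  by (simp add: graph_path_def)

lemma graph_path_Cons:
  assumes "graph_path V E u p y" "x \<in> V" "x \<notin> set p" "{x, u} \<in> E"
  shows "graph_path V E x (x # p) y"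
  using assms by (auto simp: graph_path_def successively_Cons)

lemma graph_path_rev:
  assumes "graph_path V E u p v"
  shows "graph_path V E v (rev p) u"
proof -
  have "successively (\<lambda>x y. {y, x} \<in> E) p = successively (\<lambda>x y. {x, y} \<in> E) p"
    by (rule successively_cong) (simp_all add: insert_commute)
  then show ?thesis using assms by (simp add: graph_path_def hd_rev last_rev)
qed

lemma graph_path_mono:
  assumes "graph_path V E u p v" "V \<subseteq> V'" "E \<subseteq> E'"
  shows "graph_path V' E' u p v"
  using assms successively_mono[of "\<lambda>x y. {x, y} \<in> E" p "\<lambda>x y. {x, y} \<in> E'"]
  by (auto simp: graph_path_def)

lemma graph_path_reach:
  assumes "graph_path V E u p v"
  shows "(u, v) \<in> (adjacency E)\<^sup>*"
  using assms
proof (induction p arbitrary: u)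
  case (Cons a p)
  show ?case
  proof (cases "p = []")
    case True
    then show ?thesis using Cons.prems by (auto simp: graph_path_def)
  next
    case False
    then have "graph_path V E (hd p) p v" "{u, hd p} \<in> E"
      using Cons.prems by (auto simp: graph_path_def successively_Cons)
    then show ?thesis
      using Cons.IH by (auto simp: adjacency_def intro: converse_rtrancl_into_rtrancl)
  qed
qed (simp add: graph_path_def)

lemma reach_graph_path:
  assumes "(u, v) \<in> (adjacency E)\<^sup>*" "\<Union>E \<subseteq> V" "v \<in> V"
  shows "\<exists>p. graph_path V E u p v"
  using assms(1)
proof (induction rule: converse_rtrancl_induct)
  case base
  then show ?case using graph_path_refl assms(3) by fast
next
  case (step x y)
  then obtain p where p: "graph_path V E y p v" by blast
  have e: "{x, y} \<in> E" using step(1) by (simp add: adjacency_def)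
  show ?case
  proof (cases "x \<in> set p")
    case True
    \<comment> \<open>If \<open>x\<close> is already on the path, the part before it is dropped,
      which keeps the vertices distinct.\<close>
    then obtain a b where "p = a @ x # b" by (meson split_list)
    then have "graph_path V E x (x # b) v"
      using p by (auto simp: graph_path_def successively_append_iff)
    then show ?thesis by blast
  next
    case False
    then show ?thesis using graph_path_Cons[OF p _ False e] e assms(2) by blast
  qed
qed

text \<open>Paths have distinct vertices and do not compose; reachability does. Components are
  treated as reachability classes from here on.\<close>

lemma graph_components_reach:
  assumes "\<Union>F \<subseteq> V"
  shows "graph_components V F = (\<lambda>u. (adjacency F)\<^sup>* `` {u}) ` V"
proof -
  have "{v \<in> V. \<exists>p. graph_path V F u p v} = (adjacency F)\<^sup>* `` {u}" if "u \<in> V" for u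
  proof
    show "{v \<in> V. \<exists>p. graph_path V F u p v} \<subseteq> (adjacency F)\<^sup>* `` {u}"
      using graph_path_reach by fast
    show "(adjacency F)\<^sup>* `` {u} \<subseteq> {v \<in> V. \<exists>p. graph_path V F u p v}"
    proof
      fix v assume "v \<in> (adjacency F)\<^sup>* `` {u}"
      then have "(u, v) \<in> (adjacency F)\<^sup>*" by simp
      then show "v \<in> {v \<in> V. \<exists>p. graph_path V F u p v}"
        using reach_closed[OF assms that] reach_graph_path[OF _ assms] by simp
    qed
  qed
  then show ?thesis by (simp add: graph_components_def)
qed

text \<open>This supplies the induction for every tree identity below: a new leaf \<open>v\<close>
  hung on an old vertex \<open>w\<close>.\<close>

inductive leaf_tree :: "'a set \<Rightarrow> 'a set set \<Rightarrow> bool" where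
  single: "leaf_tree {a} {}"
| leaf: "leaf_tree V E \<Longrightarrow> w \<in> V \<Longrightarrow> v \<notin> V \<Longrightarrow> leaf_tree (insert v V) (insert {v, w} E)"

lemma leaf_tree_finite:
  assumes "leaf_tree V E"
  shows "finite V" "finite E"
  using assms by (induction rule: leaf_tree.induct) auto

lemma leaf_tree_edges:
  assumes "leaf_tree V E"
  shows "\<Union>E \<subseteq> V"
  using assms by (induction rule: leaf_tree.induct) auto

context
  fixes V :: "'a set" and E :: "'a set set" and v w :: 'a
  assumes edges: "\<Union>E \<subseteq> V" and w: "w \<in> V" and v: "v \<notin> V"
begin

lemma leaf_edge_iff: "{v, x} \<in> insert {v, w} E \<longleftrightarrow> x = w"
proof -
  have "{v, x} \<notin> E" using edges v by blast
  then show ?thesis by (auto simp: doubleton_eq_iff)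
qed

text \<open>A path between old vertices that visits \<open>v\<close> would have \<open>w\<close>
  both just before and just after \<open>v\<close>, against distinctness.\<close>

lemma graph_path_avoid_leaf:
  assumes "x \<in> V" "y \<in> V"
  shows "graph_path (insert v V) (insert {v, w} E) x p y \<longleftrightarrow> graph_path V E x p y"
proof
  assume p: "graph_path (insert v V) (insert {v, w} E) x p y"
  have "v \<notin> set p"
  proof
    assume "v \<in> set p"
    then obtain a b where ab: "p = a @ v # b" by (meson split_list)
    have "a \<noteq> []" "b \<noteq> []" using p ab assms v by (auto simp: graph_path_def)
    moreover from this have "{last a, v} \<in> insert {v, w} E" "{v, hd b} \<in> insert {v, w} E"
      using p ab by (auto simp: graph_path_def successively_append_iff successively_Cons)
    then have "last a = w" "hd b = w" using leaf_edge_iff by (metis insert_commute)+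
    ultimately have "w \<in> set a" "w \<in> set b" using last_in_set hd_in_set by metis+
    then show False using p ab by (auto simp: graph_path_def)
  qed
  then have "successively (\<lambda>x y. {x, y} \<in> insert {v, w} E) p = successively (\<lambda>x y. {x, y} \<in> E) p"
    by (intro successively_cong) (auto simp: doubleton_eq_iff)
  then show "graph_path V E x p y"
    using p \<open>v \<notin> set p\<close> unfolding graph_path_def by blast
next
  assume "graph_path V E x p y"
  then show "graph_path (insert v V) (insert {v, w} E) x p y"
    by (rule graph_path_mono) auto
qed

lemma graph_path_from_leaf:
  assumes "y \<in> V"
  shows "graph_path (insert v V) (insert {v, w} E) v p y \<longleftrightarrow> (\<exists>q. p = v # q \<and> graph_path V E w q y)"
proof
  assume p: "graph_path (insert v V) (insert {v, w} E) v p y"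
  then obtain q where q: "p = v # q" by (cases p) (auto simp: graph_path_def)
  have "q \<noteq> []" using p q assms v by (auto simp: graph_path_def)
  then have "hd q = w" using p q leaf_edge_iff by (auto simp: graph_path_def successively_Cons)
  with \<open>q \<noteq> []\<close> have "graph_path (insert v V) (insert {v, w} E) w q y"
    using p q by (auto simp: graph_path_def successively_Cons)
  then show "\<exists>q. p = v # q \<and> graph_path V E w q y"
    using q graph_path_avoid_leaf[OF w assms] by blast
next
  assume "\<exists>q. p = v # q \<and> graph_path V E w q y"
  then obtain q where q: "p = v # q" "graph_path V E w q y" by blast
  have "v \<notin> set q" using q(2) v by (auto simp: graph_path_def)
  then show "graph_path (insert v V) (insert {v, w} E) v p y"
    unfolding q(1) by (intro graph_path_Cons[OF graph_path_mono[OF q(2)]]) auto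
qed

end

lemma graph_path_self_iff: "graph_path V E u p u \<longleftrightarrow> u \<in> V \<and> p = [u]"
proof
  assume p: "graph_path V E u p u"
  then obtain q where "p = u # q" by (cases p) (auto simp: graph_path_def)
  then show "u \<in> V \<and> p = [u]" using p by (cases "q = []") (auto simp: graph_path_def)
qed (auto simp: graph_path_def)

text \<open>This gives the \<open>THE\<close> in \<open>tree_dist\<close> its meaning.\<close>

lemma leaf_tree_unique_path:
  assumes "leaf_tree V E" "x \<in> V" "y \<in> V"
  shows "\<exists>!p. graph_path V E x p y"
  using assms
proof (induction arbitrary: x y rule: leaf_tree.induct)
  case (single a)
  then show ?case by (simp add: graph_path_self_iff)
next
  case (leaf V E w v)
  note ctx = leaf_tree_edges[OF leaf(1)] leaf(2,3)
  have from_v: "\<exists>!p. graph_path (insert v V) (insert {v, w} E) v p y" if "y \<in> V" for y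
    unfolding graph_path_from_leaf[OF ctx that] using leaf.IH[OF leaf(2) that] by blast
  show ?case
  proof (cases "x = v"; cases "y = v")
    assume "x \<noteq> v" "y = v"
    then have "\<exists>!p. graph_path (insert v V) (insert {v, w} E) v p x" using from_v leaf.prems by blast
    then show ?thesis using \<open>y = v\<close> graph_path_rev rev_rev_ident by metis
  next
    assume "x \<noteq> v" "y \<noteq> v"
    then show ?thesis using graph_path_avoid_leaf[OF ctx] leaf by simp
  qed (use from_v leaf.prems in \<open>auto simp: graph_path_self_iff\<close>)
qed

lemma tree_dist_eqI:
  assumes "leaf_tree V E" "graph_path V E x p y"
  shows "tree_dist V E x y = length p - 1"
proof -
  have "x \<in> V" "y \<in> V" using assms(2) by (auto simp: graph_path_def)
  then have "(THE p. graph_path V E x p y) = p"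
    using leaf_tree_unique_path[OF assms(1)] assms(2) by (blast intro: the1_equality)
  then show ?thesis by (simp add: tree_dist_def)
qed

lemma tree_dist_self: "leaf_tree V E \<Longrightarrow> x \<in> V \<Longrightarrow> tree_dist V E x x = 0"
  using tree_dist_eqI graph_path_refl by fastforce

lemma tree_dist_commute:
  assumes "leaf_tree V E" "x \<in> V" "y \<in> V"
  shows "tree_dist V E x y = tree_dist V E y x"
proof -
  obtain p where p: "graph_path V E x p y" using leaf_tree_unique_path[OF assms] by blast
  show ?thesis
    using tree_dist_eqI[OF assms(1) p] tree_dist_eqI[OF assms(1) graph_path_rev[OF p]] by simp
qed

lemma tree_dist_leaf:
  assumes "leaf_tree V E" "w \<in> V" "v \<notin> V" "y \<in> V"
  defines "d \<equiv> tree_dist (insert v V) (insert {v, w} E)"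
  shows "x \<in> V \<Longrightarrow> d x y = tree_dist V E x y"
    and "d v y = tree_dist V E w y + 1"
    and "d y v = tree_dist V E y w + 1"
proof -
  note ctx = leaf_tree_edges[OF assms(1)] assms(2,3)
  have tree: "leaf_tree (insert v V) (insert {v, w} E)" using assms(1-3) by (rule leaf_tree.leaf)
  show "d x y = tree_dist V E x y" if "x \<in> V"
    unfolding d_def tree_dist_def using graph_path_avoid_leaf[OF ctx that assms(4)] by simp
  obtain q where q: "graph_path V E w q y" using leaf_tree_unique_path assms by metis
  then have "graph_path (insert v V) (insert {v, w} E) v (v # q) y"
    using graph_path_from_leaf[OF ctx assms(4)] by blast
  from tree_dist_eqI[OF tree this] tree_dist_eqI[OF assms(1) q] q
  show *: "d v y = tree_dist V E w y + 1"
    unfolding d_def by (cases q) (auto simp: graph_path_def)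
  have "d y v = d v y" unfolding d_def using tree_dist_commute[OF tree] assms(4) by blast
  then show "d y v = tree_dist V E y w + 1"
    using * tree_dist_commute[OF assms(1,2,4)] by simp
qed

text \<open>Instead of finding a leaf to remove, a subtree on \<open>W\<close> is enlarged:
  connectedness gives an edge leaving \<open>W\<close>, and acyclicity makes its outer end a leaf
  over \<open>W\<close>.\<close>

lemma leaf_tree_grow:
  assumes "finite_tree V E" "leaf_tree W {e \<in> E. e \<subseteq> W}" "W \<subseteq> V"
  shows "leaf_tree V E"
  using assms(2,3)
proof (induction "card (V - W)" arbitrary: W rule: less_induct)
  case (less W)
  have fin: "finite V" and edge: "\<And>e. e \<in> E \<Longrightarrow> e \<subseteq> V \<and> card e = 2"
    and conn: "graph_connected V E" and acyc: "graph_acyclic V E"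
    using assms(1) by (auto simp: finite_tree_def simple_graph_def)
  show ?case
  proof (cases "W = V")
    case True
    then have "{e \<in> E. e \<subseteq> W} = E" using edge by blast
    then show ?thesis using less.prems(1) True by simp
  next
    case False
    then obtain b where b: "b \<in> V" "b \<notin> W" using less.prems(2) by blast
    obtain a where a: "a \<in> W" using less.prems(1) by (auto elim: leaf_tree.cases)
    obtain p where "graph_path V E a p b"
      using conn a b(1) less.prems(2) unfolding graph_connected_def by blast
    then have "(a, b) \<in> (adjacency E)\<^sup>*" by (rule graph_path_reach)
    \<comment> \<open>A walk from inside \<open>W\<close> to \<open>b\<close> outside has to cross
      the boundary of \<open>W\<close> at some edge.\<close>
    then have "\<exists>w x. w \<in> W \<and> x \<notin> W \<and> {w, x} \<in> E"
      using b(2)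
    proof (induction rule: rtrancl_induct)
      case (step y z)
      then show ?case by (cases "y \<in> W") (auto simp: adjacency_def)
    qed (use a in simp)
    then obtain w x where wx: "w \<in> W" "x \<notin> W" "{x, w} \<in> E" by (metis insert_commute)
    have x: "x \<in> V" using edge[OF wx(3)] by simp
    \<comment> \<open>A second neighbour of \<open>x\<close> in \<open>W\<close> would close a cycle
      with the path joining both neighbours inside \<open>W\<close>.\<close>
    have unique: "w' = w" if w': "w' \<in> W" "{x, w'} \<in> E" for w'
    proof (rule ccontr)
      assume ne: "w' \<noteq> w"
      obtain q where q: "graph_path W {e \<in> E. e \<subseteq> W} w q w'"
        using leaf_tree_unique_path[OF less.prems(1) wx(1) w'(1)] by blast
      then have q': "graph_path V E w q w'" by (rule graph_path_mono) (use less.prems(2) in auto)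
      have "x \<notin> set q" using q wx(2) by (auto simp: graph_path_def)
      then have c: "graph_path V E x (x # q) w'" using graph_path_Cons[OF q' x _ wx(3)] by simp
      \<comment> \<open>With \<open>x\<close> in front this reaches the three vertices that
        \<open>graph_cycle\<close> demands.\<close>
      have "length q \<ge> 2"
        using q ne by (cases q; cases "tl q") (auto simp: graph_path_def)
      then have "graph_cycle V E (x # q)"
        using c w'(2) by (auto simp: graph_path_def graph_cycle_def insert_commute)
      then show False using acyc by (auto simp: graph_acyclic_def)
    qed
    have "{e \<in> E. e \<subseteq> insert x W} = insert {x, w} {e \<in> E. e \<subseteq> W}" (is "?l = ?r")
    proof
      show "?r \<subseteq> ?l" using wx by auto
      show "?l \<subseteq> ?r"
      proof
        fix e assume e: "e \<in> ?l"
        show "e \<in> ?r"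
        proof (cases "x \<in> e")
          case True
          obtain y z where yz: "e = {y, z}" "y \<noteq> z" using edge[of e] e by (auto simp: card_2_iff)
          then obtain w' where "e = {x, w'}" "w' \<noteq> x" using True by blast
          then show ?thesis using unique[of w'] e by auto
        qed (use e in auto)
      qed
    qed
    then have "leaf_tree (insert x W) {e \<in> E. e \<subseteq> insert x W}"
      using leaf_tree.leaf[OF less.prems(1) wx(1,2)] by simp
    moreover have "card (V - insert x W) < card (V - W)"
      using fin x wx(2) by (intro psubset_card_mono) auto
    ultimately show ?thesis using less.hyps less.prems(2) x by blast
  qed
qed

lemma finite_tree_leaf_tree:
  assumes "finite_tree V E"
  shows "leaf_tree V E"
proof -
  obtain a where a: "a \<in> V" using assms by (auto simp: finite_tree_def graph_connected_def)
  have "{e \<in> E. e \<subseteq> {a}} = {}"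
  proof -
    have "card e \<noteq> 2" if "e \<subseteq> {a}" for e using card_mono[OF _ that] by simp
    then show ?thesis using assms by (auto simp: finite_tree_def simple_graph_def)
  qed
  then have "leaf_tree {a} {e \<in> E. e \<subseteq> {a}}" using leaf_tree.single[of a] by argo
  then show ?thesis by (rule leaf_tree_grow[OF assms]) (use a in simp)
qed

section \<open>Bordered Laplacian minors as sums over forests\<close>

text \<open>Written as a sum over edges, so that a new edge adds one term; the diagonal entries are
  the degrees.\<close>

definition laplacian :: "'a set set \<Rightarrow> 'a \<Rightarrow> 'a \<Rightarrow> real" where
  "laplacian E i j = (\<Sum>e\<in>E. if i \<in> e \<and> j \<in> e then (if i = j then 1 else - 1) else 0)"

lemma laplacian_outside:
  assumes "\<Union>E \<subseteq> V" "i \<notin> V \<or> j \<notin> V"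
  shows "laplacian E i j = 0"
  unfolding laplacian_def by (rule sum.neutral) (use assms in auto)

lemma leaf_edge_notin: "\<Union>E \<subseteq> V \<Longrightarrow> v \<notin> V \<Longrightarrow> {v, w} \<notin> E"
  by blast

lemma laplacian_insert:
  assumes "finite E" "{v, w} \<notin> E"
  shows "laplacian (insert {v, w} E) i j = laplacian E i j
    + (if i \<in> {v, w} \<and> j \<in> {v, w} then (if i = j then 1 else - 1) else 0)"
  unfolding laplacian_def using assms by simp

text \<open>\<open>None\<close> is the index of the border, which is the same for row and
  column.\<close>

fun bordered :: "('a \<Rightarrow> 'a \<Rightarrow> real) \<Rightarrow> ('a \<Rightarrow> real) \<Rightarrow> real \<Rightarrow> 'a option \<Rightarrow> 'a option \<Rightarrow> real" where
  "bordered M t c (Some i) (Some j) = M i j"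
| "bordered M t c (Some i) None = t i"
| "bordered M t c None (Some j) = t j"
| "bordered M t c None None = c"

definition rooted :: "'a set \<Rightarrow> 'a set \<Rightarrow> real" where
  "rooted S C = of_bool (\<exists>!s. s \<in> C \<and> s \<in> S)"

definition floating :: "'a set \<Rightarrow> ('a \<Rightarrow> real) \<Rightarrow> 'a set \<Rightarrow> real" where
  "floating S t C = of_bool (C \<inter> S = {}) * (sum t C)\<^sup>2"

text \<open>With \<epsilon> squared equal to 0, this is \<open>c\<close> times the constant part
  plus the \<epsilon>-part of the product over \<open>C\<close> in \<open>P\<close> of
  \<open>rooted S C\<close> - \<epsilon> \<open>floating S t C\<close>. Either all components are
  rooted, or exactly one is singled out to float.\<close>

definition forest_term :: "'a set \<Rightarrow> ('a \<Rightarrow> real) \<Rightarrow> real \<Rightarrow> 'a set set \<Rightarrow> real" where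
  "forest_term S t c P = c * prod (rooted S) P - (\<Sum>C\<in>P. floating S t C * prod (rooted S) (P - {C}))"

text \<open>All edge sets are summed over: any subset of the edges of a tree is a forest, and those
  with a wrong distribution of roots get weight 0.\<close>

definition forest_sum :: "'a set \<Rightarrow> 'a set set \<Rightarrow> 'a set \<Rightarrow> ('a \<Rightarrow> real) \<Rightarrow> real \<Rightarrow> real" where
  "forest_sum V E S t c = (\<Sum>F\<in>Pow E. forest_term S t c (graph_components V F))"

text \<open>A Leibniz rule: the floating component is either in \<open>Q\<close> or equal to
  \<open>C\<close>.\<close>

lemma forest_term_insert:
  assumes "finite Q" "C \<notin> Q"
  shows "forest_term S t c (insert C Q)
    = rooted S C * forest_term S t c Q - floating S t C * prod (rooted S) Q"
proof -
  have "prod (rooted S) (insert C Q - {B}) = rooted S C * prod (rooted S) (Q - {B})" if "B \<in> Q" for B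
  proof -
    have "insert C Q - {B} = insert C (Q - {B})" using that assms(2) by blast
    then show ?thesis using assms by simp
  qed
  then have "(\<Sum>B\<in>Q. floating S t B * prod (rooted S) (insert C Q - {B}))
      = rooted S C * (\<Sum>B\<in>Q. floating S t B * prod (rooted S) (Q - {B}))"
    by (simp add: sum_distrib_left mult.left_commute)
  moreover have "insert C Q - {C} = Q" using assms(2) by blast
  ultimately show ?thesis using assms by (simp add: forest_term_def algebra_simps)
qed

lemma forest_term_cong:
  assumes "\<And>C. C \<in> P \<Longrightarrow> rooted S C = rooted S' C"
    and "\<And>C. C \<in> P \<Longrightarrow> floating S t C = floating S' t' C"
  shows "forest_term S t c P = forest_term S' t' c P"
proof -
  have "prod (rooted S) P = prod (rooted S') P" using assms(1) by (rule prod.cong[OF refl])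
  moreover have "(\<Sum>C\<in>P. floating S t C * prod (rooted S) (P - {C}))
      = (\<Sum>C\<in>P. floating S' t' C * prod (rooted S') (P - {C}))"
    using assms by (intro sum.cong arg_cong2[where f = "(*)"] prod.cong) auto
  ultimately show ?thesis by (simp add: forest_term_def)
qed

lemma sum_Pow_insert:
  assumes "finite E" "e \<notin> E"
  shows "(\<Sum>F\<in>Pow (insert e E). h F) = (\<Sum>F\<in>Pow E. h F + h (insert e F))"
proof -
  have "(\<Sum>F\<in>Pow (insert e E). h F) = sum h (Pow E) + sum h (insert e ` Pow E)"
    unfolding Pow_insert using assms by (intro sum.union_disjoint) auto
  also have "sum h (insert e ` Pow E) = (\<Sum>F\<in>Pow E. h (insert e F))"
  proof (rule sum.reindex[unfolded comp_def])
    show "inj_on (insert e) (Pow E)"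
      using assms(2) by (intro inj_onI) (metis Diff_insert_absorb PowD subsetD)
  qed
  finally show ?thesis by (simp add: sum.distrib)
qed

lemma reach_class_eq:
  assumes "(u, w) \<in> (adjacency F)\<^sup>*"
  shows "(adjacency F)\<^sup>* `` {u} = (adjacency F)\<^sup>* `` {w}"
proof -
  have "(w, u) \<in> (adjacency F)\<^sup>*"
    using sym_rtrancl[OF sym_adjacency] assms by (rule symD)
  then show ?thesis
    using rtrancl_trans[OF assms] rtrancl_trans[of w u "adjacency F"] by blast
qed

text \<open>\<open>C\<close> is the component of \<open>w\<close>. Without the new edge
  \<open>v\<close> is a component by itself, with it \<open>v\<close> joins \<open>C\<close>; the
  others, collected in \<open>Q\<close>, stay the same.\<close>

lemma graph_components_leaf:
  assumes "finite V" "\<Union>F \<subseteq> V" "w \<in> V" "v \<notin> V"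
  obtains C Q where
    "graph_components V F = insert C Q" "C \<notin> Q" "finite Q" "w \<in> C" "\<Union>(insert C Q) \<subseteq> V" "w \<notin> \<Union>Q"
    "graph_components (insert v V) F = insert {v} (insert C Q)"
    "graph_components (insert v V) (insert {v, w} F) = insert (insert v C) Q"
proof
  let ?R = "(adjacency F)\<^sup>*"
  let ?R' = "(adjacency (insert {v, w} F))\<^sup>*"
  let ?C = "?R `` {w}"
  let ?Q = "graph_components V F - {?C}"
  have comp: "graph_components V F = (\<lambda>u. ?R `` {u}) ` V"
    using assms(2) by (rule graph_components_reach)
  have class_w: "?R `` {u} = ?C" if "(u, w) \<in> ?R" for u
    using that by (rule reach_class_eq)
  show "graph_components V F = insert ?C ?Q" unfolding comp using assms(3) by blast
  show "?C \<notin> ?Q" by blast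
  show "finite ?Q" unfolding comp using assms(1) by simp
  show "w \<in> ?C" by blast
  show "\<Union>(insert ?C ?Q) \<subseteq> V" unfolding comp using reach_closed[OF assms(2)] assms(3) by blast
  show "w \<notin> \<Union>?Q"
  proof
    assume "w \<in> \<Union>?Q"
    then obtain u where "(u, w) \<in> ?R" "?R `` {u} \<noteq> ?C" unfolding comp by blast
    then show False using class_w by blast
  qed
  have v_edges: "(v, x) \<notin> adjacency F" for x using assms(2,4) by (auto simp: adjacency_def)
  have v_class: "?R `` {v} = {v}"
  proof -
    have "x = v" if "(v, x) \<in> ?R" for x
      using that by (rule converse_rtranclE) (simp_all add: v_edges)
    then show ?thesis by blast
  qed
  have "graph_components (insert v V) F = (\<lambda>u. ?R `` {u}) ` insert v V"
    by (rule graph_components_reach) (use assms(2) in blast)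
  then show "graph_components (insert v V) F = insert {v} (insert ?C ?Q)"
    using comp v_class assms(3) by auto
  have adj: "adjacency (insert {v, w} F) = insert (v, w) (insert (w, v) (adjacency F))"
    by (rule adjacency_insert)
  have mono: "?R \<subseteq> ?R'" by (rule rtrancl_mono) (unfold adj, blast)
  \<comment> \<open>A walk that enters \<open>v\<close> can only return to \<open>w\<close>, so
    nothing new is reached but \<open>v\<close>.\<close>
  have reach: "(u, x) \<in> ?R' \<longleftrightarrow> (u, x) \<in> ?R \<or> x = v \<and> (u, w) \<in> ?R" if u: "u \<in> V" for u x
  proof
    assume "(u, x) \<in> ?R'"
    then show "(u, x) \<in> ?R \<or> x = v \<and> (u, w) \<in> ?R"
    proof (induction rule: rtrancl_induct)
      case (step y z)
      from step(2) consider "y = v" "z = w" | "y = w" "z = v" | "(y, z) \<in> adjacency F"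
        unfolding adj by blast
      then show ?case
      proof cases
        case 1
        then show ?thesis using step.IH reach_closed[OF assms(2) u] assms(4) by blast
      next
        case 2
        then show ?thesis using step.IH assms(3,4) by blast
      next
        case 3
        then have "y \<noteq> v" using v_edges by blast
        then have "(u, y) \<in> ?R" using step.IH by blast
        then show ?thesis using 3 by (meson rtrancl.rtrancl_into_rtrancl)
      qed
    qed blast
  next
    assume "(u, x) \<in> ?R \<or> x = v \<and> (u, w) \<in> ?R"
    moreover have "(w, v) \<in> adjacency (insert {v, w} F)" unfolding adj by blast
    ultimately show "(u, x) \<in> ?R'" using mono by (meson rtrancl.rtrancl_into_rtrancl subsetD)
  qed
  have class': "?R' `` {u} = (if (u, w) \<in> ?R then insert v ?C else ?R `` {u})" if "u \<in> V" for u
    using reach[OF that] class_w[of u] by auto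
  have v_class': "?R' `` {v} = insert v ?C"
  proof -
    have vw: "(v, w) \<in> ?R'" unfolding adj by blast
    have "?R' `` {v} = ?R' `` {w}"
      using vw by (rule reach_class_eq)
    then show ?thesis using class'[OF assms(3)] by simp
  qed
  have "graph_components (insert v V) (insert {v, w} F) = (\<lambda>u. ?R' `` {u}) ` insert v V"
    by (rule graph_components_reach) (use assms(2,3) in blast)
  also have "\<dots> = insert (insert v ?C) ((\<lambda>u. ?R' `` {u}) ` V)" using v_class' by simp
  also have "\<dots> = insert (insert v ?C) ?Q"
  proof (intro equalityI subsetI)
    fix X assume "X \<in> insert (insert v ?C) ((\<lambda>u. ?R' `` {u}) ` V)"
    then consider "X = insert v ?C" | u where "u \<in> V" "X = ?R' `` {u}" by blast
    then show "X \<in> insert (insert v ?C) ?Q"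
    proof cases
      case (2 u)
      show ?thesis
      proof (cases "(u, w) \<in> ?R")
        case False
        then have "?R `` {u} \<noteq> ?C" by blast
        then show ?thesis using 2 False class' comp by auto
      qed (use 2 class' in simp)
    qed simp
  next
    fix X assume "X \<in> insert (insert v ?C) ?Q"
    then consider "X = insert v ?C" | u where "u \<in> V" "X = ?R `` {u}" "X \<noteq> ?C" unfolding comp by blast
    then show "X \<in> insert (insert v ?C) ((\<lambda>u. ?R' `` {u}) ` V)"
    proof cases
      case (2 u)
      then have "(u, w) \<notin> ?R" using class_w by blast
      then have "X = ?R' `` {u}" using class'[OF 2(1)] 2(2) by simp
      then show ?thesis using 2(1) by blast
    qed simp
  qed
  finally show "graph_components (insert v V) (insert {v, w} F) = insert (insert v ?C) ?Q" .
qed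

text \<open>Without the edge, \<open>{v}\<close> has no root and must be the floating component, all
  others being rooted: this lowers the corner by \<open>(t v)\<^sup>2\<close>. With the edge,
  \<open>v\<close> hands its weight to \<open>w\<close>.\<close>

lemma forest_term_unrooted_leaf:
  assumes "finite V" "\<Union>F \<subseteq> V" "w \<in> V" "v \<notin> V" "S \<subseteq> V"
  shows "forest_term S t c (graph_components (insert v V) F)
      + forest_term S t c (graph_components (insert v V) (insert {v, w} F))
    = forest_term S (t(w := t w + t v)) (c - (t v)\<^sup>2) (graph_components V F)"
proof -
  obtain C Q where CQ: "graph_components V F = insert C Q" "C \<notin> Q" "finite Q" "w \<in> C"
      "\<Union>(insert C Q) \<subseteq> V" "w \<notin> \<Union>Q"
      "graph_components (insert v V) F = insert {v} (insert C Q)"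
      "graph_components (insert v V) (insert {v, w} F) = insert (insert v C) Q"
    using graph_components_leaf[OF assms(1-4)] by metis
  let ?t = "t(w := t w + t v)"
  have vC: "v \<notin> C" and notin: "{v} \<notin> insert C Q" "insert v C \<notin> Q" using CQ(5) assms(4) by blast+
  have "finite C" using CQ(5) assms(1) finite_subset by auto
  have vS: "v \<notin> S" using assms by blast
  have "rooted S {v} = 0" "floating S t {v} = (t v)\<^sup>2"
    using vS by (auto simp: rooted_def floating_def)
  moreover have "rooted S (insert v C) = rooted S C"
    unfolding rooted_def using vS by (metis insert_iff)
  moreover have "floating S t (insert v C) = floating S ?t C"
  proof -
    have "sum ?t C = ?t w + sum ?t (C - {w})" using CQ(4) \<open>finite C\<close> by (simp add: sum.remove)
    also have "sum ?t (C - {w}) = sum t (C - {w})" by (rule sum.cong) auto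
    finally have "sum ?t C = sum t (insert v C)"
      using CQ(4) \<open>finite C\<close> vC by (simp add: sum.remove)
    then show ?thesis using vS by (simp add: floating_def)
  qed
  moreover have "forest_term S t c Q = forest_term S ?t c Q"
  proof (rule forest_term_cong)
    fix B assume "B \<in> Q"
    then have "sum ?t B = sum t B" using CQ(6) by (intro sum.cong) auto
    then show "floating S t B = floating S ?t B" by (simp add: floating_def)
  qed simp
  moreover have "forest_term S ?t (c - (t v)\<^sup>2) Q = forest_term S ?t c Q - (t v)\<^sup>2 * prod (rooted S) Q"
    by (simp add: forest_term_def algebra_simps)
  ultimately show ?thesis
    unfolding CQ(1,7,8) using CQ(2,3) notin
    by (simp add: forest_term_insert) (simp add: algebra_simps)
qed

text \<open>Without the edge, \<open>{v}\<close> is a rooted component and splits off. With it, the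
  component of \<open>w\<close> obtains the root \<open>v\<close> and may contain no other, as if
  \<open>w\<close> itself were a new root; for \<open>w\<close> in \<open>R\<close> there would be
  two roots.\<close>

lemma forest_term_rooted_leaf:
  assumes "finite V" "\<Union>F \<subseteq> V" "w \<in> V" "v \<notin> V" "R \<subseteq> V"
  shows "forest_term (insert v R) t c (graph_components (insert v V) F)
      + forest_term (insert v R) t c (graph_components (insert v V) (insert {v, w} F))
    = forest_term R t c (graph_components V F)
      + of_bool (w \<notin> R) * forest_term (insert w R) t c (graph_components V F)"
proof -
  obtain C Q where CQ: "graph_components V F = insert C Q" "C \<notin> Q" "finite Q" "w \<in> C"
      "\<Union>(insert C Q) \<subseteq> V" "w \<notin> \<Union>Q"
      "graph_components (insert v V) F = insert {v} (insert C Q)"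
      "graph_components (insert v V) (insert {v, w} F) = insert (insert v C) Q"
    using graph_components_leaf[OF assms(1-4)] by metis
  let ?S = "insert v R"
  have vC: "v \<notin> C" and notin: "{v} \<notin> insert C Q" "insert v C \<notin> Q" using CQ(5) assms(4) by blast+
  have "rooted ?S {v} = 1" "floating ?S t {v} = 0" "floating ?S t (insert v C) = 0"
    by (auto simp: rooted_def floating_def)
  moreover have *: "rooted ?S B = rooted R B" "floating ?S t B = floating R t B" if "B \<subseteq> V" for B
    unfolding rooted_def floating_def using that assms(4) by (auto intro!: arg_cong[where f = of_bool])
  moreover have "B \<subseteq> V" if "B \<in> insert C Q" for B using CQ(5) that by blast
  then have "forest_term ?S t c (insert C Q) = forest_term R t c (insert C Q)"
      "forest_term ?S t c Q = forest_term R t c Q"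
    by (intro forest_term_cong; simp add: *)+
  moreover have "rooted ?S (insert v C) = of_bool (C \<inter> R = {})"
    unfolding rooted_def using vC assms(4,5) by (auto intro!: arg_cong[where f = of_bool])
  moreover have "of_bool (C \<inter> R = {}) = (0 :: real)" if "w \<in> R" using CQ(4) that by auto
  moreover have "rooted (insert w R) C = of_bool (C \<inter> R = {})" "floating (insert w R) t C = 0" if "w \<notin> R"
    unfolding rooted_def floating_def using that CQ(4) by (auto intro!: arg_cong[where f = of_bool])
  moreover have "forest_term (insert w R) t c Q = forest_term R t c Q"
  proof (rule forest_term_cong)
    fix B assume "B \<in> Q"
    then have "w \<notin> B" using CQ(6) by blast
    then show "rooted (insert w R) B = rooted R B" "floating (insert w R) t B = floating R t B"
      unfolding rooted_def floating_def by (auto intro!: arg_cong[where f = of_bool])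
  qed
  ultimately show ?thesis
    unfolding CQ(1,7,8) using CQ(2,3) notin
    by (cases "w \<in> R") (simp_all add: forest_term_insert)
qed

lemma forest_sum_leaf:
  assumes "leaf_tree V E" "v \<notin> V"
  shows "forest_sum (insert v V) (insert {v, w} E) S t c
    = (\<Sum>F\<in>Pow E. forest_term S t c (graph_components (insert v V) F)
        + forest_term S t c (graph_components (insert v V) (insert {v, w} F)))"
  unfolding forest_sum_def
  by (rule sum_Pow_insert[OF leaf_tree_finite(2)[OF assms(1)]])
    (rule leaf_edge_notin[OF leaf_tree_edges[OF assms(1)] assms(2)])

lemma forest_sum_unrooted_leaf:
  assumes "leaf_tree V E" "w \<in> V" "v \<notin> V" "S \<subseteq> V"
  shows "forest_sum (insert v V) (insert {v, w} E) S t c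
    = forest_sum V E S (t(w := t w + t v)) (c - (t v)\<^sup>2)"
proof -
  have "\<Union>F \<subseteq> V" if "F \<in> Pow E" for F using that leaf_tree_edges[OF assms(1)] by blast
  then show ?thesis
    unfolding forest_sum_leaf[OF assms(1,3)] unfolding forest_sum_def
    using forest_term_unrooted_leaf[OF leaf_tree_finite(1)[OF assms(1)] _ assms(2-4)]
    by (intro sum.cong) auto
qed

lemma forest_sum_rooted_leaf:
  assumes "leaf_tree V E" "w \<in> V" "v \<notin> V" "R \<subseteq> V"
  shows "forest_sum (insert v V) (insert {v, w} E) (insert v R) t c
    = forest_sum V E R t c + of_bool (w \<notin> R) * forest_sum V E (insert w R) t c"
proof -
  have "\<Union>F \<subseteq> V" if "F \<in> Pow E" for F using that leaf_tree_edges[OF assms(1)] by blast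
  then show ?thesis
    unfolding forest_sum_leaf[OF assms(1,3)]
    unfolding forest_sum_def sum_distrib_left sum.distrib[symmetric]
    using forest_term_rooted_leaf[OF leaf_tree_finite(1)[OF assms(1)] _ assms(2-4)]
    by (intro sum.cong) auto
qed

lemma forest_sum_single:
  "forest_sum {a} {} S t c = c * rooted S {a} - floating S t {a}"
proof -
  have "graph_components {a} {} = {{a}}"
    by (subst graph_components_reach) (auto simp: adjacency_def)
  then show ?thesis by (simp add: forest_sum_def forest_term_def)
qed

text \<open>Eliminating a leaf \<open>v\<close> with neighbour \<open>w\<close>: an unrooted \<open>v\<close> is a pivot \<open>1\<close>, which moves
  its weight to \<open>w\<close> when the edge is kept and contributes \<open>(t v)\<^sup>2\<close> when \<open>v\<close> floats alone; a
  rooted \<open>v\<close> only adds \<open>1\<close> to the diagonal entry of \<open>w\<close>.\<close>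

theorem bordered_matrix_forest:
  assumes "leaf_tree V E" "S \<subseteq> V"
  shows "set_det (insert None (Some ` (V - S))) (bordered (laplacian E) t c) = forest_sum V E S t c"
  using assms
proof (induction arbitrary: S t c rule: leaf_tree.induct)
  case (single a)
  let ?f = "bordered (laplacian {}) t c"
  consider "S = {}" | "S = {a}" using single by blast
  then show ?case
  proof cases
    case 1
    have lap0: "laplacian {} a a = 0" by (simp add: laplacian_def)
    \<comment> \<open>The diagonal entry is 0 and no pivot. Raised to 1 it gives
      \<open>c - (t a)\<^sup>2\<close>, and the correction by linearity takes \<open>c\<close> away
      again.\<close>
    let ?g = "\<lambda>i j. if i = Some a \<and> j = Some a then 1 else ?f i j"
    have "set_det (insert (Some a) {None}) ?f
        = set_det (insert (Some a) {None}) ?g + (?f (Some a) (Some a) - ?g (Some a) (Some a)) * set_det {None} ?g"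
      by (rule set_det_insert_diff) auto
    also have "set_det (insert (Some a) {None}) ?g = set_det {None} (\<lambda>i j. ?g i j - ?g i (Some a) * ?g (Some a) j)"
      by (rule set_det_pivot) auto
    finally have "set_det (insert (Some a) {None}) ?f = - (t a)\<^sup>2"
      by (simp add: set_det_singleton lap0 power2_eq_square)
    then show ?thesis
      unfolding forest_sum_single using 1 by (simp add: rooted_def floating_def insert_commute Ex1_def)
  next
    case 2
    then show ?thesis unfolding forest_sum_single by (simp add: set_det_singleton rooted_def floating_def)
  qed
next
  case (leaf V E w v)
  note fin = leaf_tree_finite[OF leaf(1)] and edges = leaf_tree_edges[OF leaf(1)]
  have new: "{v, w} \<notin> E" using leaf_edge_notin[OF edges leaf(3)] .
  have vw: "v \<noteq> w" using leaf(2,3) by blast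
  note lap = laplacian_insert[OF fin(2) new]
  let ?L = "bordered (laplacian (insert {v, w} E)) t c"
  show ?case
  proof (cases "v \<in> S")
    case False
    then have S: "S \<subseteq> V" using leaf.prems by blast
    let ?A = "insert None (Some ` (V - S))"
    let ?t = "t(w := t w + t v)"
    have v0: "laplacian E i v = 0" "laplacian E v i = 0" for i
      using laplacian_outside[OF edges] leaf(3) by blast+
    have "insert v V - S = insert v (V - S)" using False by blast
    then have "set_det (insert None (Some ` (insert v V - S))) ?L = set_det (insert (Some v) ?A) ?L"
      by (simp add: insert_commute)
    also have "\<dots> = set_det ?A (\<lambda>i j. ?L i j - ?L i (Some v) * ?L (Some v) j)"
      by (rule set_det_pivot) (use fin leaf(3) v0 in \<open>auto simp: lap\<close>)
    \<comment> \<open>The row of \<open>v\<close> is -1 at \<open>w\<close> and \<open>t v\<close>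
      at the border. The elimination cancels the 1 that the new edge put at \<open>(w, w)\<close>,
      adds \<open>t v\<close> to the border at \<open>w\<close> and takes
      \<open>(t v)\<^sup>2\<close> off the corner.\<close>
    also have "\<dots> = set_det ?A (bordered (laplacian E) ?t (c - (t v)\<^sup>2))"
    proof (rule set_det_cong)
      fix i j assume ij: "i \<in> ?A" "j \<in> ?A"
      show "?L i j - ?L i (Some v) * ?L (Some v) j = bordered (laplacian E) ?t (c - (t v)\<^sup>2) i j"
        using ij vw leaf(3) v0 by (cases i; cases j) (auto simp: lap power2_eq_square)
    qed (use fin in simp)
    also have "\<dots> = forest_sum V E S ?t (c - (t v)\<^sup>2)" by (rule leaf.IH[OF S])
    also have "\<dots> = forest_sum (insert v V) (insert {v, w} E) S t c"
      by (rule forest_sum_unrooted_leaf[OF leaf(1-3) S, symmetric])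
    finally show ?thesis .
  next
    case True
    define R where "R = S - {v}"
    have S: "S = insert v R" and R: "R \<subseteq> V" using True leaf.prems by (auto simp: R_def)
    let ?A = "insert None (Some ` (V - R))"
    let ?M = "bordered (laplacian E) t c"
    have VS: "insert v V - S = V - R" using S R leaf(3) by blast
    have L: "?L i j = ?M i j + of_bool (i = Some w \<and> j = Some w)" if "i \<in> ?A" "j \<in> ?A" for i j
      using that vw leaf(3) by (cases i; cases j) (auto simp: lap)
    \<comment> \<open>The coefficient of the entry at \<open>(w, w)\<close> is the minor with
      \<open>w\<close> deleted too, that is, with \<open>w\<close> as a root. For \<open>w\<close>
      in \<open>R\<close> that entry is absent.\<close>
    have "set_det ?A ?L = set_det ?A ?M + of_bool (w \<notin> R) * set_det (?A - {Some w}) ?M"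
    proof (cases "w \<in> R")
      case True
      then have "set_det ?A ?L = set_det ?A ?M"
        using fin(1) by (intro set_det_cong) (auto simp: L)
      then show ?thesis using True by simp
    next
      case False
      then have wA: "Some w \<in> ?A" using leaf(2) by simp
      have "set_det (insert (Some w) (?A - {Some w})) ?L = set_det (insert (Some w) (?A - {Some w})) ?M
          + (?L (Some w) (Some w) - ?M (Some w) (Some w)) * set_det (?A - {Some w}) ?M"
      proof (rule set_det_insert_diff)
        fix i j assume "i \<in> ?A - {Some w}" "j \<in> insert (Some w) (?A - {Some w})"
        then show "?L i j = ?M i j" using L[of i j] wA by auto
      next
        fix j assume "j \<in> ?A - {Some w}"
        then show "?L (Some w) j = ?M (Some w) j" using L[OF wA, of j] by auto
      qed (use fin in auto)
      then show ?thesis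
        unfolding insert_Diff[OF wA] using L[OF wA wA] False by simp
    qed
    also have "?A - {Some w} = insert None (Some ` (V - insert w R))" by auto
    also have "set_det ?A ?M = forest_sum V E R t c" by (rule leaf.IH[OF R])
    also have "set_det (insert None (Some ` (V - insert w R))) ?M = forest_sum V E (insert w R) t c"
      by (rule leaf.IH) (use R leaf(2) in simp)
    also have "forest_sum V E R t c + of_bool (w \<notin> R) * forest_sum V E (insert w R) t c
        = forest_sum (insert v V) (insert {v, w} E) S t c"
      unfolding S by (rule forest_sum_rooted_leaf[OF leaf(1-3) R, symmetric])
    finally show ?thesis unfolding VS .
  qed
qed

section \<open>The inverse of the bordered distance matrix\<close>

text \<open>\<open>rooted {}\<close> is always 0, so only a forest with a single component, floating
  as a whole, has nonzero weight. The induction moves all the weight to one vertex.\<close>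

lemma forest_sum_no_roots:
  assumes "leaf_tree V E"
  shows "forest_sum V E {} t c = - (sum t V)\<^sup>2"
  using assms
proof (induction arbitrary: t c rule: leaf_tree.induct)
  case (single a)
  show ?case unfolding forest_sum_single by (simp add: rooted_def floating_def Ex1_def)
next
  case (leaf V E w v)
  let ?t = "t(w := t w + t v)"
  have fin: "finite V" using leaf_tree_finite(1)[OF leaf(1)] .
  have "sum ?t V = ?t w + sum ?t (V - {w})" using leaf(2) fin by (simp add: sum.remove)
  also have "sum ?t (V - {w}) = sum t (V - {w})" by (rule sum.cong) auto
  finally have "sum ?t V = sum t (insert v V)" using leaf(2,3) fin by (simp add: sum.remove)
  then show ?case
    using forest_sum_unrooted_leaf[OF leaf(1-3) empty_subsetI] leaf.IH by simp
qed

text \<open>The vector \<open>2 - deg\<close>, which is the equilibrium measure of the distance matrix up to scaling.\<close>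

definition curvature :: "'a set set \<Rightarrow> 'a \<Rightarrow> real" where
  "curvature E i = 2 - (\<Sum>e\<in>E. of_bool (i \<in> e))"

text \<open>The outdegree of an arbitrary vertex set, as a real number; at the floating component it
  becomes \<open>outdeg\<close>.\<close>

definition boundary_size :: "'a set set \<Rightarrow> 'a set \<Rightarrow> real" where
  "boundary_size E C = (\<Sum>e\<in>E. of_bool (card (e \<inter> C) = 1))"

lemma curvature_insert:
  assumes "finite E" "{v, w} \<notin> E"
  shows "curvature (insert {v, w} E) i = curvature E i - of_bool (i \<in> {v, w})"
  unfolding curvature_def using assms by simp

lemma curvature_outside:
  assumes "\<Union>E \<subseteq> V" "v \<notin> V"
  shows "curvature E v = 2"
proof -
  have "(\<Sum>e\<in>E. of_bool (v \<in> e) :: real) = 0"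
    by (rule sum.neutral) (use assms in auto)
  then show ?thesis by (simp add: curvature_def)
qed

lemma sum_curvature_leaf:
  assumes "leaf_tree V E" "v \<notin> V" "C \<subseteq> V"
  shows "sum (curvature (insert {v, w} E)) C = sum (curvature E) C - of_bool (w \<in> C)"
proof -
  have "finite C" using assms leaf_tree_finite(1) finite_subset by metis
  note ins = curvature_insert[OF leaf_tree_finite(2)[OF assms(1)]
      leaf_edge_notin[OF leaf_tree_edges[OF assms(1)] assms(2)]]
  have "sum (curvature (insert {v, w} E)) C = (\<Sum>i\<in>C. curvature E i - of_bool (i = w))"
    using assms(2,3) by (intro sum.cong) (auto simp: ins)
  also have "\<dots> = sum (curvature E) C - of_bool (w \<in> C)"
    using \<open>finite C\<close> by (simp add: sum_subtractf of_bool_def)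
  finally show ?thesis .
qed

text \<open>\<open>C\<close> induces a subtree with \<open>card C - 1\<close> inner edges, so its
  degrees add up to \<open>2 (card C - 1)\<close> plus the number of boundary edges.\<close>

lemma sum_curvature_component:
  assumes "leaf_tree V E" "F \<subseteq> E" "C \<in> graph_components V F"
  shows "sum (curvature E) C = 2 - boundary_size E C"
  using assms
proof (induction arbitrary: F C rule: leaf_tree.induct)
  case (single a)
  then have "F = {}" by simp
  then have "graph_components {a} F = {{a}}"
    by (subst graph_components_reach) (auto simp: adjacency_def)
  then show ?case using single by (simp add: curvature_def boundary_size_def)
next
  case (leaf V E w v)
  note fin = leaf_tree_finite[OF leaf(1)] and edges = leaf_tree_edges[OF leaf(1)]
  have new: "{v, w} \<notin> E" using leaf_edge_notin[OF edges leaf(3)] .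
  have vw: "v \<noteq> w" using leaf(2,3) by blast
  let ?E = "insert {v, w} E"
  have bd: "boundary_size ?E B = of_bool (card ({v, w} \<inter> B) = 1) + boundary_size E B" for B
    unfolding boundary_size_def using fin(2) new by simp
  note cv = curvature_insert[OF fin(2) new, of v] curvature_outside[OF edges leaf(3)]
  \<comment> \<open>The new edge leaves a set of old vertices exactly if it contains
    \<open>w\<close>, and then the degree of \<open>w\<close> has grown by one.\<close>
  have old: "sum (curvature ?E) B = 2 - boundary_size ?E B"
    if B: "B \<subseteq> V" "sum (curvature E) B = 2 - boundary_size E B" for B
  proof -
    have "{v, w} \<inter> B = (if w \<in> B then {w} else {})" using B(1) leaf(3) by auto
    then show ?thesis using B(2) sum_curvature_leaf[OF leaf(1,3) B(1)] by (simp add: bd)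
  qed
  let ?F = "F - {{v, w}}"
  have F: "?F \<subseteq> E" "F = ?F \<or> F = insert {v, w} ?F" using leaf.prems by blast+
  have FV: "\<Union>?F \<subseteq> V" using F(1) edges by blast
  obtain B Q where BQ: "graph_components V ?F = insert B Q" "w \<in> B"
      "\<Union>(insert B Q) \<subseteq> V"
      "graph_components (insert v V) ?F = insert {v} (insert B Q)"
      "graph_components (insert v V) (insert {v, w} ?F) = insert (insert v B) Q"
    using graph_components_leaf[OF fin(1) FV leaf(2,3)] by metis
  have IH: "X \<subseteq> V" "sum (curvature E) X = 2 - boundary_size E X" if "X \<in> insert B Q" for X
    using BQ(3) that leaf.IH[OF F(1)] unfolding BQ(1) by blast+
  have "C \<in> insert B Q \<or> C = {v} \<or> C = insert v B"
    using F(2) leaf.prems(2) BQ(4,5) by auto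
  then consider "C \<in> insert B Q" | "C = {v}" | "C = insert v B" by blast
  then show ?case
  proof cases
    case 1
    then show ?thesis using old IH by blast
  next
    case 2
    have "boundary_size E {v} = 0"
      unfolding boundary_size_def
    proof (intro sum.neutral ballI)
      fix e assume "e \<in> E"
      then have "e \<inter> {v} = {}" using edges leaf(3) by blast
      then show "(of_bool (card (e \<inter> {v}) = 1) :: real) = 0" by simp
    qed
    then show ?thesis using 2 cv by (simp add: bd)
  next
    case 3
    have B: "B \<subseteq> V" "sum (curvature E) B = 2 - boundary_size E B" using IH by blast+
    have "boundary_size E (insert v B) = boundary_size E B"
      unfolding boundary_size_def
    proof (rule sum.cong)
      fix e assume "e \<in> E"
      then have "e \<inter> insert v B = e \<inter> B" using edges leaf(3) by blast
      then show "(of_bool (card (e \<inter> insert v B) = 1) :: real) = of_bool (card (e \<inter> B) = 1)" by simp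
    qed simp
    moreover have "{v, w} \<inter> insert v B = {v, w}" using BQ(2) by blast
    moreover have "v \<notin> B" "finite B" using B(1) leaf(3) fin(1) finite_subset by blast+
    ultimately show ?thesis
      using 3 B(2) BQ(2) cv vw sum_curvature_leaf[OF leaf(1,3) B(1), of w] by (simp add: bd)
  qed
qed

text \<open>The handshake lemma for n - 1 edges.\<close>

lemma sum_curvature:
  assumes "leaf_tree V E"
  shows "sum (curvature E) V = 2"
  using assms
proof (induction rule: leaf_tree.induct)
  case (single a)
  then show ?case by (simp add: curvature_def)
next
  case (leaf V E w v)
  have "curvature (insert {v, w} E) v = 1"
    using curvature_insert[OF leaf_tree_finite(2)[OF leaf(1)] leaf_edge_notin[OF leaf_tree_edges[OF leaf(1)] leaf(3)]]
      curvature_outside[OF leaf_tree_edges[OF leaf(1)] leaf(3)] by simp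
  then show ?case
    using sum_curvature_leaf[OF leaf(1,3) order_refl, of w] leaf.IH leaf_tree_finite(1)[OF leaf(1)] leaf(2,3)
    by simp
qed

section \<open>The Laplacian and the degrees applied to distances\<close>

lemma sum_laplacian_leaf:
  assumes "leaf_tree V E" "w \<in> V" "v \<notin> V" "i \<in> V"
  shows "(\<Sum>k\<in>V. laplacian (insert {v, w} E) i k * h k)
    = (\<Sum>k\<in>V. laplacian E i k * h k) + of_bool (i = w) * h w"
proof -
  note lap = laplacian_insert[OF leaf_tree_finite(2)[OF assms(1)]
      leaf_edge_notin[OF leaf_tree_edges[OF assms(1)] assms(3)]]
  have "(\<Sum>k\<in>V. laplacian (insert {v, w} E) i k * h k)
      = (\<Sum>k\<in>V. laplacian E i k * h k + (if k = w then of_bool (i = w) * h k else 0))"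
    using assms(2-4) by (intro sum.cong) (auto simp: lap algebra_simps)
  also have "\<dots> = (\<Sum>k\<in>V. laplacian E i k * h k) + of_bool (i = w) * h w"
    using leaf_tree_finite(1)[OF assms(1)] assms(2) by (simp add: sum.distrib)
  finally show ?thesis .
qed

lemma sum_laplacian_at_leaf:
  assumes "leaf_tree V E" "w \<in> V" "v \<notin> V"
  shows "(\<Sum>k\<in>V. laplacian (insert {v, w} E) v k * h k) = - h w"
    and "laplacian (insert {v, w} E) v v = 1"
    and "i \<in> V \<Longrightarrow> laplacian (insert {v, w} E) i v = - of_bool (i = w)"
proof -
  note edges = leaf_tree_edges[OF assms(1)]
  note lap = laplacian_insert[OF leaf_tree_finite(2)[OF assms(1)] leaf_edge_notin[OF edges assms(3)]]
  have out: "laplacian E v k = 0" "laplacian E k v = 0" for k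
    using laplacian_outside[OF edges] assms(3) by blast+
  have "(\<Sum>k\<in>V. laplacian (insert {v, w} E) v k * h k) = (\<Sum>k\<in>V. if k = w then - h k else 0)"
    using assms(2,3) by (intro sum.cong) (auto simp: lap out)
  also have "\<dots> = - h w" using leaf_tree_finite(1)[OF assms(1)] assms(2) by simp
  finally show "(\<Sum>k\<in>V. laplacian (insert {v, w} E) v k * h k) = - h w" .
  show "laplacian (insert {v, w} E) v v = 1" by (simp add: lap out)
  show "laplacian (insert {v, w} E) i v = - of_bool (i = w)" if "i \<in> V"
    using that assms(2,3) by (auto simp: lap out)
qed

lemma laplacian_row_sum:
  assumes "leaf_tree V E" "i \<in> V"
  shows "(\<Sum>k\<in>V. laplacian E i k) = 0"
  using assms
proof (induction arbitrary: i rule: leaf_tree.induct)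
  case (single a)
  then show ?case by (simp add: laplacian_def)
next
  case (leaf V E w v)
  note fin = leaf_tree_finite(1)[OF leaf(1)]
  note at_leaf = sum_laplacian_at_leaf[OF leaf(1-3)]
  show ?case
  proof (cases "i = v")
    case True
    then show ?thesis using at_leaf(1)[of "\<lambda>_. 1"] at_leaf(2) fin leaf(3) by simp
  next
    case False
    then have i: "i \<in> V" using leaf.prems by blast
    then show ?thesis
      using at_leaf(3)[OF i] sum_laplacian_leaf[OF leaf(1-3) i, of "\<lambda>_. 1"] leaf.IH[OF i] fin leaf(3)
      by simp
  qed
qed

text \<open>For \<open>i\<close> other than \<open>j\<close>, one neighbour of \<open>i\<close> is
  nearer to \<open>j\<close> by 1 and the others are farther by 1, which gives 2 minus the degree.
  At \<open>i = j\<close> all neighbours are farther: minus the degree.\<close>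

lemma laplacian_tree_dist:
  assumes "leaf_tree V E" "i \<in> V" "j \<in> V"
  shows "(\<Sum>k\<in>V. laplacian E i k * real (tree_dist V E k j)) = curvature E i - 2 * of_bool (i = j)"
  using assms
proof (induction arbitrary: i j rule: leaf_tree.induct)
  case (single a)
  then show ?case by (simp add: laplacian_def curvature_def)
next
  case (leaf V E w v)
  note fin = leaf_tree_finite(1)[OF leaf(1)] and edges = leaf_tree_edges[OF leaf(1)]
  note at_leaf = sum_laplacian_at_leaf[OF leaf(1-3)] and not_leaf = sum_laplacian_leaf[OF leaf(1-3)]
  note curv = curvature_insert[OF leaf_tree_finite(2)[OF leaf(1)] leaf_edge_notin[OF edges leaf(3)]]
    curvature_outside[OF edges leaf(3)]
  let ?L = "laplacian (insert {v, w} E)" and ?d = "tree_dist (insert v V) (insert {v, w} E)"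
  have dvv: "?d v v = 0" using tree_dist_self[OF leaf_tree.leaf[OF leaf(1-3)]] by simp
  have split: "(\<Sum>k\<in>insert v V. ?L i k * real (?d k j)) = ?L i v * real (?d v j) + (\<Sum>k\<in>V. ?L i k * real (?d k j))"
    for i j using fin leaf(3) by simp
  show ?case
  proof (cases "j = v")
    case True
    have dj: "(\<Sum>k\<in>V. ?L i k * real (?d k j)) = (\<Sum>k\<in>V. ?L i k * (real (tree_dist V E k w) + 1))"
      unfolding True by (rule sum.cong) (use tree_dist_leaf(3)[OF leaf(1-3)] in auto)
    have dww: "tree_dist V E w w = 0" using tree_dist_self[OF leaf(1,2)] .
    show ?thesis
    proof (cases "i = v")
      case i: True
      then show ?thesis unfolding split dj unfolding True i at_leaf(1) by (simp add: dvv dww curv)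
    next
      case False
      then have i: "i \<in> V" using leaf.prems by blast
      \<comment> \<open>Distances to the leaf are distances to \<open>w\<close> plus 1; the shift
        disappears because the rows of the Laplacian sum to 0.\<close>
      have "(\<Sum>k\<in>V. laplacian E i k * (real (tree_dist V E k w) + 1)) = curvature E i - 2 * of_bool (i = w)"
        using leaf.IH[OF i leaf(2)] laplacian_row_sum[OF leaf(1) i]
        by (simp add: distrib_left sum.distrib)
      then show ?thesis
        unfolding split dj unfolding True not_leaf[OF i] using False by (simp add: dvv dww curv)
    qed
  next
    case False
    then have j: "j \<in> V" using leaf.prems by blast
    have dj: "(\<Sum>k\<in>V. ?L i k * real (?d k j)) = (\<Sum>k\<in>V. ?L i k * real (tree_dist V E k j))"
      by (rule sum.cong) (use tree_dist_leaf(1)[OF leaf(1-3) j] in auto)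
    have dv: "?d v j = tree_dist V E w j + 1" using tree_dist_leaf(2)[OF leaf(1-3) j] .
    show ?thesis
    proof (cases "i = v")
      case i: True
      then show ?thesis unfolding split dj unfolding i at_leaf(1) using False by (simp add: dv at_leaf(2) curv)
    next
      case False
      then have i: "i \<in> V" using leaf.prems by blast
      show ?thesis
        unfolding split dj not_leaf[OF i] leaf.IH[OF i j] at_leaf(3)[OF i] dv
        using False by (simp add: curv algebra_simps)
    qed
  qed
qed

text \<open>Independence of \<open>j\<close> reflects that \<open>L D\<close> maps \<tau> to 2
  \<tau> - 2 \<tau> = 0 and that the kernel of \<open>L\<close> consists of constants. The induction
  finds the constant directly: each leaf adds 1.\<close>

lemma curvature_tree_dist:
  assumes "leaf_tree V E" "j \<in> V"
  shows "(\<Sum>k\<in>V. curvature E k * real (tree_dist V E k j)) = real (card V) - 1"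
  using assms
proof (induction arbitrary: j rule: leaf_tree.induct)
  case (single a)
  then show ?case using tree_dist_self[OF leaf_tree.single[of a]] by simp
next
  case (leaf V E w v)
  note fin = leaf_tree_finite(1)[OF leaf(1)] and edges = leaf_tree_edges[OF leaf(1)]
  note curv = curvature_insert[OF leaf_tree_finite(2)[OF leaf(1)] leaf_edge_notin[OF edges leaf(3)]]
  let ?c = "curvature (insert {v, w} E)" and ?d = "tree_dist (insert v V) (insert {v, w} E)"
  have cv: "?c v = 1" using curv curvature_outside[OF edges leaf(3)] by simp
  have split: "(\<Sum>k\<in>insert v V. ?c k * real (?d k j)) = real (?d v j) + (\<Sum>k\<in>V. ?c k * real (?d k j))"
    for j using fin leaf(3) cv by simp
  have sum: "(\<Sum>k\<in>V. ?c k * h k) = (\<Sum>k\<in>V. curvature E k * h k) - h w" for h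
  proof -
    have "(\<Sum>k\<in>V. ?c k * h k) = (\<Sum>k\<in>V. curvature E k * h k - (if k = w then h k else 0))"
      using leaf(3) by (intro sum.cong) (auto simp: curv algebra_simps)
    then show ?thesis using fin leaf(2) by (simp add: sum_subtractf)
  qed
  show ?case
  proof (cases "j = v")
    case True
    have "(\<Sum>k\<in>V. ?c k * real (?d k j)) = (\<Sum>k\<in>V. ?c k * (real (tree_dist V E k w) + 1))"
      unfolding True by (rule sum.cong) (use tree_dist_leaf(3)[OF leaf(1-3)] in auto)
    \<comment> \<open>The 2 is the total curvature, collected by the shift of all distances by 1;
      the last 1 is the loss at \<open>w\<close>, whose distance to the leaf is 1.\<close>
    also have "\<dots> = real (card V) - 1 + 2 - 1"
      unfolding sum using leaf.IH[OF leaf(2)] sum_curvature[OF leaf(1)] tree_dist_self[OF leaf(1,2)]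
      by (simp add: distrib_left sum.distrib)
    finally show ?thesis
      unfolding split using True tree_dist_self[OF leaf_tree.leaf[OF leaf(1-3)]] fin leaf(3) by simp
  next
    case False
    then have j: "j \<in> V" using leaf.prems by blast
    have "(\<Sum>k\<in>V. ?c k * real (?d k j)) = (\<Sum>k\<in>V. ?c k * real (tree_dist V E k j))"
      by (rule sum.cong) (use tree_dist_leaf(1)[OF leaf(1-3) j] in auto)
    then show ?thesis
      unfolding split sum leaf.IH[OF j] tree_dist_leaf(2)[OF leaf(1-3) j] using fin leaf(3) by simp
  qed
qed

text \<open>The determinant of the whole bordered matrix, needed in Jacobi's complementary minor
  theorem, comes from its instance \<open>S = {}\<close>.\<close>

lemma set_det_tree_dist:
  assumes "leaf_tree V E" "S \<subseteq> V"
  defines "d \<equiv> \<lambda>i j. real (tree_dist V E i j)"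
  shows "set_det (Some ` S) (bordered d (\<lambda>_. 1) 0)
    = - ((- 2) ^ card S / 4) * forest_sum V E S (\<lambda>i. - curvature E i) (real (card V) - 1)"
proof -
  let ?t = "\<lambda>i. - curvature E i" and ?c = "real (card V) - 1"
  let ?f = "bordered d (\<lambda>_. 1) 0"
  let ?g = "\<lambda>x y. (- 1 / 2) * bordered (laplacian E) ?t ?c x y"
  let ?W = "insert None (Some ` V)"
  have fin: "finite V" using leaf_tree_finite(1)[OF assms(1)] .
  have W: "(\<Sum>k\<in>?W. h k) = h None + (\<Sum>k\<in>V. h (Some k))" for h :: "'a option \<Rightarrow> real"
    using fin by (simp add: sum.reindex)
  have inv: "(\<Sum>k\<in>?W. ?g x k * ?f k y) = of_bool (x = y)" if "x \<in> ?W" "y \<in> ?W" for x y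
  proof (cases x; cases y)
    fix i j assume "x = Some i" "y = Some j"
    then show ?thesis
      unfolding W using laplacian_tree_dist[OF assms(1), of i j] that
      by (auto simp: d_def sum_negf sum_divide_distrib[symmetric] diff_divide_distrib)
  next
    fix i assume "x = Some i" "y = None"
    then show ?thesis
      unfolding W using laplacian_row_sum[OF assms(1), of i] that
      by (auto simp: sum_negf sum_divide_distrib[symmetric])
  next
    fix j assume "x = None" "y = Some j"
    then show ?thesis
      unfolding W using curvature_tree_dist[OF assms(1), of j] that
      by (auto simp: d_def sum_negf sum_divide_distrib[symmetric])
  next
    assume "x = None" "y = None"
    then show ?thesis
      unfolding W using sum_curvature[OF assms(1)]
      by (simp add: sum_divide_distrib[symmetric])
  qed
  have minor: "set_det (insert None (Some ` (V - R))) ?g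
      = (- 1 / 2) ^ (card V - card R + 1) * forest_sum V E R ?t ?c" if "R \<subseteq> V" for R
  proof -
    have "card (insert None (Some ` (V - R))) = card V - card R + 1"
      using fin that by (simp add: card_image card_Diff_subset finite_subset)
    then show ?thesis
      using set_det_scale[of "insert None (Some ` (V - R))" "- 1 / 2" "bordered (laplacian E) ?t ?c"]
        bordered_matrix_forest[OF assms(1) that] fin by simp
  qed
  have jacobi: "set_det (insert None (Some ` (V - R))) ?g * set_det ?W ?f = set_det (Some ` R) ?f"
    if "R \<subseteq> V" for R
  proof -
    have "Some ` R \<union> insert None (Some ` (V - R)) = ?W" using that by blast
    then show ?thesis
      using set_det_jacobi[of "Some ` R" "insert None (Some ` (V - R))" ?g ?f] inv fin that
        finite_subset[OF that fin] by auto
  qed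
  let ?n = "card V" and ?s = "card S"
  have s: "?s \<le> ?n" using assms(2) fin card_mono by blast
  \<comment> \<open>The total curvature 2, squared.\<close>
  have "forest_sum V E {} ?t ?c = - 4"
    using forest_sum_no_roots[OF assms(1)] sum_curvature[OF assms(1)] by (simp add: sum_negf)
  \<comment> \<open>For \<open>R = {}\<close> the minor of \<open>?f\<close> is empty and equals 1,
    which determines \<open>set_det ?W ?f\<close>.\<close>
  then have "(- 1 / 2) ^ (?n + 1) * (- 4) * set_det ?W ?f = 1"
    using jacobi[of "{}"] minor[of "{}"] by simp
  \<comment> \<open>Split so as to isolate the power that belongs to the minor for \<open>S\<close>;
    the natural subtraction is exact as \<open>?s\<close> is at most \<open>?n\<close>.\<close>
  moreover have "(- 1 / 2 :: real) ^ (?n + 1) = (- 1 / 2) ^ (?n - ?s + 1) * (- 1 / 2) ^ ?s"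
    using s by (simp add: power_add[symmetric])
  ultimately have "(- 1 / 2) ^ (?n - ?s + 1) * set_det ?W ?f * (- 1 / 2) ^ ?s = - 1 / 4"
    by (simp add: algebra_simps)
  then have "(- 1 / 2) ^ (?n - ?s + 1) * set_det ?W ?f * ((- 1 / 2) ^ ?s * (- 2) ^ ?s) = - 1 / 4 * (- 2) ^ ?s"
    by (simp only: mult.assoc[symmetric])
  then have det: "(- 1 / 2) ^ (?n - ?s + 1) * set_det ?W ?f = - ((- 2) ^ ?s / 4)"
    by (simp add: power_mult_distrib[symmetric])
  have "set_det (Some ` S) ?f
      = (- 1 / 2) ^ (?n - ?s + 1) * set_det ?W ?f * forest_sum V E S ?t ?c"
    unfolding jacobi[OF assms(2), symmetric] minor[OF assms(2)] by (simp only: mult_ac)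
  then show ?thesis unfolding det .
qed

section \<open>Rooted and floating forests\<close>

lemma graph_acyclic_mono: "graph_acyclic V E \<Longrightarrow> F \<subseteq> E \<Longrightarrow> graph_acyclic V F"
  unfolding graph_acyclic_def graph_cycle_def
  using successively_mono[of "\<lambda>x y. {x, y} \<in> F" _ "\<lambda>x y. {x, y} \<in> E"] by blast

text \<open>Replaces the counts in the definition by a condition on each component, the form in
  which \<open>forest_term\<close> sees a forest.\<close>

lemma floating_rooted_forests_iff:
  assumes "finite V" "\<Union>F \<subseteq> V" "S \<subseteq> V"
  shows "F \<in> floating_rooted_forests V E S \<longleftrightarrow> spanning_forest V E F \<and>
    (\<exists>C\<in>graph_components V F. C \<inter> S = {} \<and>
      (\<forall>B\<in>graph_components V F - {C}. \<exists>!s. s \<in> B \<and> s \<in> S))"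
proof -
  let ?P = "graph_components V F" and ?R = "(adjacency F)\<^sup>*"
  define one where "one = (\<lambda>C. \<exists>!s. s \<in> C \<and> s \<in> S)"
  define K where "K = {C \<in> ?P. one C}"
  have comp: "?P = (\<lambda>u. ?R `` {u}) ` V" using assms(2) by (rule graph_components_reach)
  have finP: "finite ?P" unfolding comp using assms(1) by simp
  have KP: "K \<subseteq> ?P" by (simp add: K_def)
  then have finK: "finite K" using finP by (rule finite_subset)
  have one_meets: "C \<inter> S \<noteq> {}" if "one C" for C using that unfolding one_def by blast
  have one_unique: "s = t" if "one C" "s \<in> C" "s \<in> S" "t \<in> C" "t \<in> S" for C s t
    using that unfolding one_def by blast
  have "card ?P = card S + 1 \<and> card K = card S \<and> (\<exists>!C. C \<in> ?P \<and> C \<inter> S = {})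
    \<longleftrightarrow> (\<exists>C\<in>?P. C \<inter> S = {} \<and> (\<forall>B\<in>?P - {C}. one B))"
  proof
    assume a: "card ?P = card S + 1 \<and> card K = card S \<and> (\<exists>!C. C \<in> ?P \<and> C \<inter> S = {})"
    then have "\<exists>C. C \<in> ?P \<and> C \<inter> S = {}" by (blast dest: ex1_implies_ex)
    then obtain C where C: "C \<in> ?P" "C \<inter> S = {}" by blast
    then have "C \<notin> K" using one_meets by (auto simp: K_def)
    \<comment> \<open>The rooted components and \<open>C\<close> together number
      \<open>card S + 1\<close>, hence they are all of \<open>?P\<close>.\<close>
    then have "card (insert C K) = card ?P" using a finK by simp
    then have "insert C K = ?P" using C(1) KP card_subset_eq[OF finP, of "insert C K"] by simp
    then have "one B" if "B \<in> ?P - {C}" for B using that by (auto simp: K_def)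
    then show "\<exists>C\<in>?P. C \<inter> S = {} \<and> (\<forall>B\<in>?P - {C}. one B)" using C by blast
  next
    assume "\<exists>C\<in>?P. C \<inter> S = {} \<and> (\<forall>B\<in>?P - {C}. one B)"
    then obtain C where C: "C \<in> ?P" "C \<inter> S = {}" and one: "\<And>B. B \<in> ?P - {C} \<Longrightarrow> one B" by blast
    have K: "K = ?P - {C}" using one one_meets C(2) by (auto simp: K_def)
    \<comment> \<open>Sending a root to its component is injective because no component in
      \<open>K\<close> has two roots, and onto \<open>K\<close> because each has one.\<close>
    have "bij_betw (\<lambda>s. ?R `` {s}) S K"
    proof (rule bij_betw_imageI)
      have mem: "?R `` {s} \<in> K" if "s \<in> S" for s
      proof -
        have "?R `` {s} \<in> ?P" unfolding comp using that assms(3) by blast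
        moreover have "?R `` {s} \<noteq> C" using C(2) that by blast
        ultimately show ?thesis unfolding K by simp
      qed
      show "inj_on (\<lambda>s. ?R `` {s}) S"
      proof (rule inj_onI)
        fix s t assume st: "s \<in> S" "t \<in> S" "?R `` {s} = ?R `` {t}"
        have "one (?R `` {s})" using mem[OF st(1)] by (simp add: K_def)
        moreover have "s \<in> ?R `` {s}" by blast
        moreover have "t \<in> ?R `` {s}" unfolding st(3) by blast
        ultimately show "s = t" using st(1,2) one_unique by blast
      qed
      show "(\<lambda>s. ?R `` {s}) ` S = K"
      proof
        show "(\<lambda>s. ?R `` {s}) ` S \<subseteq> K" using mem by blast
        show "K \<subseteq> (\<lambda>s. ?R `` {s}) ` S"
        proof
          fix B assume "B \<in> K"
          then have "B \<in> ?P" "B \<inter> S \<noteq> {}" using one_meets by (simp_all add: K_def)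
          then obtain u s where us: "B = ?R `` {u}" "s \<in> B" "s \<in> S" unfolding comp by blast
          then have "B = ?R `` {s}" using reach_class_eq[of u s F] by simp
          then show "B \<in> (\<lambda>s. ?R `` {s}) ` S" using us(3) by blast
        qed
      qed
    qed
    then have "card S = card K" by (rule bij_betw_same_card)
    moreover have "card ?P = Suc (card K)"
      unfolding K using card_Suc_Diff1[OF finP C(1)] by simp
    moreover have "\<exists>!C. C \<in> ?P \<and> C \<inter> S = {}"
    proof (rule ex1I[of _ C])
      fix B assume B: "B \<in> ?P \<and> B \<inter> S = {}"
      then have "\<not> one B" using one_meets by blast
      then show "B = C" using one B by blast
    qed (use C in simp)
    ultimately show "card ?P = card S + 1 \<and> card K = card S \<and> (\<exists>!C. C \<in> ?P \<and> C \<inter> S = {})"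
      by simp
  qed
  then show ?thesis unfolding floating_rooted_forests_def one_def K_def by simp
qed

lemma prod_of_bool: "finite P \<Longrightarrow> (\<Prod>x\<in>P. of_bool (Q x) :: real) = of_bool (\<forall>x\<in>P. Q x)"
  by (induction P rule: finite_induct) auto

text \<open>At most one summand of \<open>forest_term\<close> survives, that of the floating
  component, whose weight is \<open>outdeg\<close> minus 2.\<close>

lemma forest_term_curvature:
  assumes tree: "leaf_tree V E" and acyc: "graph_acyclic V E" and "S \<subseteq> V" "F \<subseteq> E"
  shows "forest_term S (\<lambda>i. - curvature E i) c (graph_components V F)
    = c * of_bool (F \<in> rooted_forests V E S)
      - of_bool (F \<in> floating_rooted_forests V E S) * (real (outdeg V E S F) - 2)\<^sup>2"
proof -
  let ?P = "graph_components V F" and ?t = "\<lambda>i. - curvature E i"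
  let ?one = "\<lambda>C. \<exists>!s. s \<in> C \<and> s \<in> S"
  note fin = leaf_tree_finite[OF tree]
  have FV: "\<Union>F \<subseteq> V" using assms(4) leaf_tree_edges[OF tree] by blast
  have sf: "spanning_forest V E F"
    using assms(4) graph_acyclic_mono[OF acyc] by (simp add: spanning_forest_def)
  have finP: "finite ?P" unfolding graph_components_def using fin by simp
  have rooted: "prod (rooted S) B = of_bool (\<forall>C\<in>B. ?one C)" if "B \<subseteq> ?P" for B
    unfolding rooted_def using prod_of_bool[OF finite_subset[OF that finP]] .
  have R: "prod (rooted S) ?P = of_bool (F \<in> rooted_forests V E S)"
    using rooted[of ?P] sf by (simp add: rooted_forests_def)
  let ?float = "\<lambda>C. C \<inter> S = {} \<and> (\<forall>B\<in>?P - {C}. ?one B)"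
  note iff = floating_rooted_forests_iff[OF fin(1) FV assms(3), of E]
  have sum: "(\<Sum>C\<in>?P. floating S ?t C * prod (rooted S) (?P - {C}))
      = (\<Sum>C\<in>?P. of_bool (?float C) * (sum ?t C)\<^sup>2)"
    by (rule sum.cong) (auto simp: floating_def rooted)
  have "(\<Sum>C\<in>?P. of_bool (?float C) * (sum ?t C)\<^sup>2)
      = of_bool (F \<in> floating_rooted_forests V E S) * (real (outdeg V E S F) - 2)\<^sup>2"
  proof (cases "F \<in> floating_rooted_forests V E S")
    case False
    then have "\<not> ?float C" if "C \<in> ?P" for C using iff sf that by blast
    then have "(\<Sum>C\<in>?P. of_bool (?float C) * (sum ?t C)\<^sup>2) = 0"
      by (intro sum.neutral ballI) (simp only: of_bool_eq mult_zero_left)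
    then show ?thesis using False by simp
  next
    case True
    then obtain C where C: "C \<in> ?P" "?float C" using iff by blast
    have ex1: "\<exists>!C. C \<in> ?P \<and> C \<inter> S = {}"
      using True by (simp add: floating_rooted_forests_def)
    then have fc: "floating_component V S F = B" if "B \<in> ?P" "B \<inter> S = {}" for B
      unfolding floating_component_def using that by (intro the1_equality conjI)
    \<comment> \<open>Such a \<open>B\<close> would also miss \<open>S\<close>, and the component
      missing \<open>S\<close> is unique.\<close>
    have "\<not> ?float B" if "B \<in> ?P - {C}" for B
      using fc[of B] fc[OF C(1)] C(2) that by fastforce
    then have "(\<Sum>B\<in>?P - {C}. of_bool (?float B) * (sum ?t B)\<^sup>2) = 0"
      by (intro sum.neutral ballI) (simp only: of_bool_eq mult_zero_left)
    then have "(\<Sum>B\<in>?P. of_bool (?float B) * (sum ?t B)\<^sup>2) = of_bool (?float C) * (sum ?t C)\<^sup>2"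
      using sum.remove[OF finP C(1), of "\<lambda>B. of_bool (?float B) * (sum ?t B)\<^sup>2"] by linarith
    moreover have "sum ?t C = boundary_size E C - 2"
      using sum_curvature_component[OF tree assms(4) C(1)] by (simp add: sum_negf)
    moreover have "boundary_size E C = real (outdeg V E S F)"
      using fin(2) fc[OF C(1)] C(2) by (simp add: boundary_size_def outdeg_def Int_def)
    ultimately show ?thesis using True C(2) by simp
  qed
  then show ?thesis unfolding forest_term_def R sum by simp
qed

lemma forest_sum_curvature:
  assumes tree: "leaf_tree V E" and acyc: "graph_acyclic V E" and "S \<subseteq> V"
  shows "forest_sum V E S (\<lambda>i. - curvature E i) c = c * real (kappa V E S)
    - (\<Sum>F\<in>floating_rooted_forests V E S. (real (outdeg V E S F) - 2)\<^sup>2)"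
proof -
  have fin: "finite (Pow E)" using leaf_tree_finite(2)[OF tree] by simp
  have sub: "rooted_forests V E S \<subseteq> Pow E" "floating_rooted_forests V E S \<subseteq> Pow E"
    by (auto simp: rooted_forests_def floating_rooted_forests_def spanning_forest_def)
  have restrict: "(\<Sum>F\<in>Pow E. of_bool (F \<in> A) * h F) = sum h A" if "A \<subseteq> Pow E" for A and h :: "_ \<Rightarrow> real"
    using sum.inter_restrict[OF fin, of h A] that
    by (simp add: Int_absorb1 of_bool_def if_distrib[of "\<lambda>x. x * _"] cong: if_cong)
  have "forest_sum V E S (\<lambda>i. - curvature E i) c
      = (\<Sum>F\<in>Pow E. of_bool (F \<in> rooted_forests V E S) * c)
        - (\<Sum>F\<in>Pow E. of_bool (F \<in> floating_rooted_forests V E S) * (real (outdeg V E S F) - 2)\<^sup>2)"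
    unfolding forest_sum_def sum_subtractf[symmetric]
    by (rule sum.cong) (simp_all add: forest_term_curvature[OF assms] mult.commute)
  then show ?thesis unfolding restrict[OF sub(1)] restrict[OF sub(2)] by (simp add: kappa_def)
qed

section \<open>From vertex sets back to matrices\<close>

lemma set_det_image:
  assumes "finite A" "inj_on h A"
  shows "set_det (h ` A) f = set_det A (\<lambda>i j. f (h i) (h j))"
proof -
  obtain xs where xs: "set xs = A" "distinct xs" using finite_distinct_list[OF assms(1)] by blast
  have "distinct (map h xs)" using xs assms(2) by (simp add: distinct_map)
  from set_det_eq_list_det[OF this, of f]
  have "set_det (h ` A) f = list_det (map h xs) f" by (simp add: xs(1))
  also have "\<dots> = list_det xs (\<lambda>i j. f (h i) (h j))"
    unfolding list_det_def by (intro arg_cong[where f = det] eq_matI) auto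
  finally show ?thesis using set_det_eq_list_det[OF xs(2)] xs(1) by simp
qed

text \<open>\<open>submatrix\<close> takes the selected positions in increasing order through
  \<open>pick\<close>, so it is the matrix of the list \<open>xs\<close>, an enumeration of
  \<open>S\<close> in the order of \<open>vs\<close>.\<close>

lemma det_principal_submatrix:
  assumes "distinct vs" "S \<subseteq> set vs"
  shows "det (principal_submatrix (mat (length vs) (length vs) (\<lambda>(i, j). f (vs ! i) (vs ! j))) (positions vs S))
    = set_det S f"
proof -
  let ?I = "positions vs S" and ?n = "length vs"
  let ?k = "card ?I"
  have I: "finite ?I" "{i. i < ?n \<and> i \<in> ?I} = ?I" by (auto simp: positions_def)
  have pick: "pick ?I i \<in> ?I" if "i < ?k" for i using pick_in_set_le that by blast
  then have pick_less: "pick ?I i < ?n" if "i < ?k" for i using that by (auto simp: positions_def)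
  define xs where "xs = map (\<lambda>i. vs ! pick ?I i) [0..<?k]"
  have inj: "inj_on (\<lambda>i. vs ! pick ?I i) {..<?k}"
  proof (rule inj_onI)
    fix i j assume ij: "i \<in> {..<?k}" "j \<in> {..<?k}" "vs ! pick ?I i = vs ! pick ?I j"
    then have "pick ?I i = pick ?I j"
      using assms(1) pick_less by (simp add: nth_eq_iff_index_eq)
    then show "i = j"
      using ij pick_mono_le[of i ?I j] pick_mono_le[of j ?I i]
      by (metis lessThan_iff less_irrefl linorder_neqE_nat)
  qed
  have dist: "distinct xs"
    using inj by (simp add: xs_def distinct_map atLeast0LessThan)
  have "bij_betw (\<lambda>i. vs ! i) ?I S"
  proof (rule bij_betw_imageI)
    show "inj_on (\<lambda>i. vs ! i) ?I"
      using assms(1) by (auto simp: inj_on_def positions_def nth_eq_iff_index_eq)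
    show "(\<lambda>i. vs ! i) ` ?I = S"
      using assms(2) by (force simp: positions_def in_set_conv_nth)
  qed
  then have card: "?k = card S" by (rule bij_betw_same_card)
  have "set xs \<subseteq> S" using pick by (auto simp: xs_def positions_def)
  moreover have "card (set xs) = card S"
    using distinct_card[OF dist] card by (simp add: xs_def)
  moreover have "finite S" using assms(2) finite_subset by blast
  ultimately have "set xs = S" by (simp add: card_subset_eq)
  have "principal_submatrix (mat ?n ?n (\<lambda>(i, j). f (vs ! i) (vs ! j))) ?I
      = mat (length xs) (length xs) (\<lambda>(i, j). f (xs ! i) (xs ! j))"
    unfolding principal_submatrix_def submatrix_def
    by (rule eq_matI) (auto simp: I xs_def pick_less)
  then show ?thesis
    using set_det_eq_list_det[OF dist, of f] \<open>set xs = S\<close> by (simp add: list_det_def)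
qed

theorem theoremA:
  fixes V S :: "'a set" and E :: "'a set set" and vs :: "'a list" and n :: nat
  assumes "finite_tree V E"
    and "card V = n"
    and "distinct vs" and "set vs = V"
    and "S \<subseteq> V" and "S \<noteq> {}"
  shows "det (principal_submatrix (distance_matrix V E vs) (positions vs S)) =
    (-1) ^ (card S - 1) * 2 powi (int (card S) - 2) *
    ((real n - 1) * real (kappa V E S)
      - (\<Sum>F\<in>floating_rooted_forests V E S. (real (outdeg V E S F) - 2)\<^sup>2))"
proof -
  let ?d = "\<lambda>i j. real (tree_dist V E i j)"
  have tree: "leaf_tree V E" using assms(1) by (rule finite_tree_leaf_tree)
  have acyc: "graph_acyclic V E" using assms(1) by (simp add: finite_tree_def)
  have finS: "finite S" using assms(5) leaf_tree_finite(1)[OF tree] finite_subset by blast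
  \<comment> \<open>The leading minus lowers the exponent of -1 by one, which is exact in
    \<open>nat\<close> because \<open>S\<close> is nonempty. The exponent of 2 is -1 when
    \<open>S\<close> has one element, hence \<open>powi\<close>.\<close>
  have sign: "- ((- 2) ^ card S / 4) = (-1) ^ (card S - 1) * (2 :: real) powi (int (card S) - 2)"
  proof -
    obtain k where k: "card S = Suc k" using assms(6) finS by (cases "card S") auto
    have "(2 :: real) powi (int (card S) - 2) = 2 ^ card S / 4"
      by (simp add: power_int_diff)
    moreover have "(- 2 :: real) ^ card S = (- 1) ^ card S * 2 ^ card S"
      by (simp add: power_mult_distrib[symmetric])
    ultimately show ?thesis by (simp add: k)
  qed
  have "det (principal_submatrix (distance_matrix V E vs) (positions vs S)) = set_det S ?d"
    unfolding distance_matrix_def using assms(3-5) by (intro det_principal_submatrix) auto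
  also have "\<dots> = set_det (Some ` S) (bordered ?d (\<lambda>_. 1) 0)"
    using set_det_image[OF finS, of Some "bordered ?d (\<lambda>_. 1) 0"] by simp
  also have "\<dots> = - ((- 2) ^ card S / 4) * forest_sum V E S (\<lambda>i. - curvature E i) (real n - 1)"
    using set_det_tree_dist[OF tree assms(5)] assms(2) by simp
  finally show ?thesis
    unfolding sign forest_sum_curvature[OF tree acyc assms(5)] .
qed

end
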